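(* Let $c_1 = \sqrt[80]{2\theta(80)}$, where $\theta(80) = 1302375489530691442230524528$ (so $c_1 = 2.201\ldots$). Then for all positive integers $n \geq 45$, \[ \theta(n) \geq \frac{c_1^n}{2}. \]
   Context: For a positive integer $n$, let $[n]=\{1,2,\ldots,n\}$. A permutation $(a_1,a_2,\ldots,a_n)$ of $[n]$ is called 3-free if there do not exist indices $i<j<k$ with $a_i + a_k = 2a_j$, i.e., it contains no 3-term arithmetic progression as a subsequence. $\theta(n)$ denotes the number of 3-free permutations of $[n]$. *)

theory Defs
  imports Complex_Main "HOL-Combinatorics.Multiset_Permutations"
begin

definition three_free :: "nat list \<Rightarrow> bool" where
  "three_free xs \<longleftrightarrow>
     \<not> (\<exists>i j k. i < j \<and> j < k \<and> k < length xs \<and> xs ! i + xs ! k = 2 * xs ! j)"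

text \<open>
  A permutation of \<open>{1..n}\<close> is the list of its values in order
  (\<^const>\<open>permutations_of_set\<close>), not a bijective function.
\<close>

definition theta :: "nat \<Rightarrow> nat" where
  "theta n = card {xs \<in> permutations_of_set {1..n}. three_free xs}"

end

(*
  A 3-free permutation of {0..<n} splits into its even and its odd letters, which are 3-free again after halving. Call two letters
  of different parity near if they are neighbours or two consecutive terms of a progression in {0..<n}. One parity class precedes
  the other at all near pairs: for neighbours this spreads along the alternation forced by progressions with difference 2, and an
  induction over the distance does the rest. Conversely every such shuffle is 3-free. Hence a prefix of a 3-free permutation is
  described by a recursively nested state with few possibilities (about 8600 for n = 80), and counting words through the graph of
  states gives theta n exactly. The same splitting gives theta n >= 2 theta (ceiling (n/2)) theta (floor (n/2)), which carries the
  bound c1^n <= 2 theta n from finitely many exact values to all n.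
*)
theory Submission
  imports Defs
begin

section \<open>Words and their parity classes\<close>

text \<open>The base \<open>c1\<close> is the largest one for which the bound holds at 80, where it
  is an equality. If the halves of n are a and b, the halving inequality reads 2 theta n \<ge> (2
  theta a) (2 theta b), so the bounds for a and b give the bound for n. The obstacle is that the
  bound fails at 37 and at 43. The induction therefore avoids the range 37..43, but every n in
  73..87 has a half in it, and these n must be settled by numbers: exact values for 74..86, products
  of exact values at 73 and 87. Words of such lengths are far too many to be listed, which is why
  prefixes leading to the same state are counted together. Real roots stay out of the computation:
  replacing \<open>c1\<close> by the larger 262/119 leaves inequalities between integers. This
  fraction cannot be much coarser, since it must not exceed the 81st root of 2 theta 81; and it is
  too large at 80 itself, where the definition of \<open>c1\<close> is used instead.\<close>

primrec before :: "nat list \<Rightarrow> nat \<Rightarrow> nat \<Rightarrow> bool" where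
  "before [] a b \<longleftrightarrow> False"
| "before (c # w) a b \<longleftrightarrow> c = a \<and> b \<in> set w \<or> before w a b"

lemma before_in_set: "before w a b \<Longrightarrow> a \<in> set w \<and> b \<in> set w"
  by (induction w) auto

lemma before_asym: "distinct w \<Longrightarrow> before w a b \<Longrightarrow> \<not> before w b a"
  by (induction w) (auto dest: before_in_set)

lemma before_total: "a \<in> set w \<Longrightarrow> b \<in> set w \<Longrightarrow> a \<noteq> b \<Longrightarrow> before w a b \<or> before w b a"
  by (induction w) auto

lemma before_trans: "distinct w \<Longrightarrow> before w a b \<Longrightarrow> before w b c \<Longrightarrow> before w a c"
  by (induction w) (auto dest: before_in_set)

lemma before_append: "before (u @ v) a b \<longleftrightarrow> before u a b \<or> before v a b \<or> a \<in> set u \<and> b \<in> set v"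
  by (induction u) auto

lemma before_rev: "before (rev w) a b \<longleftrightarrow> before w b a"
  by (induction w) (auto simp: before_append)

lemma before_nth: "before w a b \<longleftrightarrow> (\<exists>i j. i < j \<and> j < length w \<and> w ! i = a \<and> w ! j = b)"
proof (induction w)
  case (Cons c w)
  show ?case
  proof
    assume "before (c # w) a b"
    then consider "c = a" "b \<in> set w" | "before w a b" by auto
    then show "\<exists>i j. i < j \<and> j < length (c # w) \<and> (c # w) ! i = a \<and> (c # w) ! j = b"
    proof cases
      case 1
      then obtain j where "j < length w" "w ! j = b" by (auto simp: in_set_conv_nth)
      with 1 show ?thesis by (intro exI[of _ 0] exI[of _ "Suc j"]) auto
    next
      case 2
      then obtain i j where "i < j" "j < length w" "w ! i = a" "w ! j = b" using Cons by auto
      then show ?thesis by (intro exI[of _ "Suc i"] exI[of _ "Suc j"]) auto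
    qed
  next
    assume "\<exists>i j. i < j \<and> j < length (c # w) \<and> (c # w) ! i = a \<and> (c # w) ! j = b"
    then obtain i j where ij: "i < j" "j < length (c # w)" "(c # w) ! i = a" "(c # w) ! j = b" by auto
    then obtain j' where j: "j = Suc j'" by (cases j) auto
    show "before (c # w) a b"
    proof (cases i)
      case 0
      then show ?thesis using ij j by auto
    next
      case (Suc i')
      then show ?thesis using ij j Cons by auto
    qed
  qed
qed simp

lemma three_free_iff_before:
  assumes "distinct w"
  shows "three_free w \<longleftrightarrow> (\<forall>a m z. a + z = 2 * m \<longrightarrow> before w a m \<longrightarrow> \<not> before w m z)"
proof
  assume tf: "three_free w"
  show "\<forall>a m z. a + z = 2 * m \<longrightarrow> before w a m \<longrightarrow> \<not> before w m z"
  proof (intro allI impI notI)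
    fix a m z assume "a + z = 2 * m" "before w a m" "before w m z"
    then obtain i j j' k where *: "i < j" "j < length w" "w ! i = a" "w ! j = m"
      "j' < k" "k < length w" "w ! j' = m" "w ! k = z" by (auto simp: before_nth)
    then have "j = j'" using assms nth_eq_iff_index_eq[of w j j'] by simp
    with * \<open>a + z = 2 * m\<close> tf show False unfolding three_free_def by blast
  qed
next
  assume *: "\<forall>a m z. a + z = 2 * m \<longrightarrow> before w a m \<longrightarrow> \<not> before w m z"
  show "three_free w" unfolding three_free_def
  proof clarify
    fix i j k assume "i < j" "j < k" "k < length w" "w ! i + w ! k = 2 * w ! j"
    moreover from this have "before w (w ! i) (w ! j)" "before w (w ! j) (w ! k)"
      unfolding before_nth using less_trans by blast+
    ultimately show False using * by blast
  qed
qed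

text \<open>With letters starting at 0, division by 2 maps the even letters onto an initial segment
  again, and likewise the odd ones, so the splitting can be iterated.\<close>

definition free_perms :: "nat \<Rightarrow> nat list set" where
  "free_perms n = {w. distinct w \<and> set w = {..<n} \<and> three_free w}"

lemma three_free_map_Suc: "three_free (map Suc w) \<longleftrightarrow> three_free w"
proof -
  have "(map Suc w ! i + map Suc w ! k = 2 * map Suc w ! j) \<longleftrightarrow> (w ! i + w ! k = 2 * w ! j)"
    if "i < j" "j < k" "k < length w" for i j k using that by auto
  then show ?thesis unfolding three_free_def length_map by blast
qed

lemma theta_eq_card_free_perms: "theta n = card (free_perms n)"
proof -
  have "{xs \<in> permutations_of_set {1..n}. three_free xs} = map Suc ` free_perms n"
  proof (intro equalityI subsetI)
    fix xs assume "xs \<in> {xs \<in> permutations_of_set {1..n}. three_free xs}"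
    then have xs: "set xs = {1..n}" "distinct xs" "three_free xs" by (auto dest: permutations_of_setD)
    define w where "w = map (\<lambda>x. x - 1) xs"
    have eq: "xs = map Suc w"
      using xs(1) by (auto simp: w_def o_def intro!: map_idI[symmetric])
    have "Suc ` set w = Suc ` {..<n}"
      using xs(1) by (simp add: eq image_Suc_lessThan)
    then have "set w = {..<n}" by (simp add: inj_image_eq_iff)
    then have "w \<in> free_perms n"
      using xs by (simp add: free_perms_def eq three_free_map_Suc distinct_map)
    then show "xs \<in> map Suc ` free_perms n" using eq by blast
  next
    fix xs assume "xs \<in> map Suc ` free_perms n"
    then obtain w where w: "xs = map Suc w" "distinct w" "set w = {..<n}" "three_free w" by (auto simp: free_perms_def)
    then have "set xs = {1..n}" "distinct xs" "three_free xs"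
      using image_Suc_lessThan[of n] by (simp_all add: distinct_map three_free_map_Suc)
    then show "xs \<in> {xs \<in> permutations_of_set {1..n}. three_free xs}"
      by (simp add: permutations_of_set_def)
  qed
  moreover have "inj_on (map Suc) (free_perms n)" by (rule inj_onI) (simp add: inj_map_eq_map)
  ultimately show ?thesis
    unfolding theta_def by (metis card_image)
qed

lemma free_perms_before:
  "w \<in> free_perms n \<longleftrightarrow> distinct w \<and> set w = {..<n} \<and> (\<forall>a m z. a + z = 2 * m \<longrightarrow> before w a m \<longrightarrow> \<not> before w m z)"
  unfolding free_perms_def using three_free_iff_before by blast

lemma rev_in_free_perms: "w \<in> free_perms n \<Longrightarrow> rev w \<in> free_perms n"
  unfolding free_perms_before before_rev set_rev distinct_rev by (metis add.commute)

section \<open>Halving a parity class of a word\<close>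

definition half :: "nat \<Rightarrow> nat list \<Rightarrow> nat list" where
  "half p w = map (\<lambda>x. x div 2) (filter (\<lambda>x. x mod 2 = p) w)"

lemma half_simps [simp]:
  "half p [] = []"
  "half p (x # w) = (if x mod 2 = p then x div 2 # half p w else half p w)"
  by (auto simp: half_def)

lemma half_rev: "half p (rev w) = rev (half p w)"
  by (simp add: half_def rev_filter rev_map)

lemma mod_div_2_iff: "p < 2 \<Longrightarrow> x = 2 * i + p \<longleftrightarrow> x mod 2 = p \<and> x div 2 = i" for x p i :: nat
  using mult_div_mod_eq[of 2 x] by auto

lemma set_half: "p < 2 \<Longrightarrow> i \<in> set (half p w) \<longleftrightarrow> 2 * i + p \<in> set w"
proof (induction w)
  case (Cons x w)
  then show ?case using mod_div_2_iff[of p x i] by (cases "x = 2 * i + p") auto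
qed simp

lemma distinct_half: "distinct w \<Longrightarrow> p < 2 \<Longrightarrow> distinct (half p w)"
proof (induction w)
  case (Cons x w)
  then show ?case using set_half[of p "x div 2" w] mod_div_2_iff[of p x "x div 2"] by (cases "x mod 2 = p") auto
qed simp

lemma before_half: "p < 2 \<Longrightarrow> before (half p w) a b \<longleftrightarrow> before w (2 * a + p) (2 * b + p)"
proof (induction w)
  case (Cons x w)
  then show ?case using set_half[of p b w] mod_div_2_iff[of p x a] by (cases "x = 2 * a + p") auto
qed simp

section \<open>The forced order between even and odd letters\<close>

text \<open>\<open>near m x y\<close>: x and y are neighbours, or one of them is the middle of a progression in \<open>{0..m}\<close> that starts
  at the other.\<close>

definition near :: "nat \<Rightarrow> nat \<Rightarrow> nat \<Rightarrow> bool" where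
  "near m x y \<longleftrightarrow> x + 1 = y \<or> y + 1 = x \<or> (x \<le> y + y \<and> y + y \<le> m + x) \<or> (y \<le> x + x \<and> x + x \<le> m + y)"

lemma near_commute: "near m x y \<longleftrightarrow> near m y x"
  by (auto simp: near_def)

text \<open>In a 3-free word both ends of a progression lie on the same side of its middle;
  \<open>ap\<close> is this property. The order is an abstract \<open>lt\<close>, so that the lemma
  applies to a word read in either direction.\<close>

lemma even_before_near_odd:
  fixes lt :: "nat \<Rightarrow> nat \<Rightarrow> bool"
  assumes tot: "\<And>a b. a < n \<Longrightarrow> b < n \<Longrightarrow> a \<noteq> b \<Longrightarrow> lt a b \<longleftrightarrow> \<not> lt b a"
    and tr: "\<And>a b c. lt a b \<Longrightarrow> lt b c \<Longrightarrow> lt a c"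
    and ap: "\<And>a m z. a < n \<Longrightarrow> z < n \<Longrightarrow> a \<noteq> z \<Longrightarrow> a + z = 2 * m \<Longrightarrow> lt a m \<longleftrightarrow> lt z m"
    and "lt 0 1"
    and xy: "x < n" "y < n" "even x" "odd y" "near (n - 1) x y"
  shows "lt x y"
proof -
  have nb: "x + 1 < n \<Longrightarrow> if even x then lt x (x + 1) else lt (x + 1) x" for x
  proof (induction x)
    case 0
    then show ?case using \<open>lt 0 1\<close> by simp
  next
    case (Suc x)
    then show ?case using ap[of x "x + 2" "x + 1"] tot[of "x + 1" "x + 2"] tot[of x "x + 1"]
      by (auto split: if_splits)
  qed
  \<comment> \<open>Three consecutive letters of the same parity form a progression, so ascents and
    descents alternate along x, x + 2, x + 4, ...\<close>
  have alt: "x + 2 * j + 2 < n \<Longrightarrow> lt (x + 2 * j + 2) (x + 2 * j) \<longleftrightarrow> (if even j then lt (x + 2) x else \<not> lt (x + 2) x)" for x j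
  proof (induction j)
    case (Suc j)
    define a b c where "a = x + 2 * j" and "b = a + 2" and "c = b + 2"
    have "x + 2 * Suc j = b" "x + 2 * Suc j + 2 = c" "x + 2 * j + 2 = b" "x + 2 * j = a"
      by (simp_all add: a_def b_def c_def)
    then have *: "b < n \<Longrightarrow> lt b a \<longleftrightarrow> (if even j then lt (x + 2) x else \<not> lt (x + 2) x)" and "c < n"
      and goal: "lt (x + 2 * Suc j + 2) (x + 2 * Suc j) = lt c b" using Suc by metis+
    have "lt a b \<longleftrightarrow> lt c b" "lt a b \<longleftrightarrow> \<not> lt b a"
      using ap[of a c b] tot[of a b] \<open>c < n\<close> by (auto simp: b_def c_def)
    then show ?case unfolding goal using * \<open>c < n\<close> by (auto simp: c_def)
  qed simp
  have mid: "x + 2 * (2 * k + 1) < n \<Longrightarrow>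
      if even x then lt x (x + (2 * k + 1)) else lt (x + (2 * k + 1)) x" for x k
  proof (induction k arbitrary: x)
    case 0
    then have "x + 1 < n" by simp
    from nb[OF this] show ?case by (cases "even x") simp_all
  next
    case (Suc k)
    define d where "d = 2 * k + 3"
    have d: "x + 2 * d < n" "d \<ge> 3" using Suc.prems by (auto simp: d_def)
    \<comment> \<open>The progression with start x + 2 and difference d - 2 has the same middle x +
      d as the one with start x and difference d; the induction compares these two nested
      progressions.\<close>
    have eqs: "x + 2 + (2 * k + 1) = x + d" "even (x + 2) = even x" "x + 2 + 2 * (2 * k + 1) < n"
      using Suc.prems by (auto simp: d_def)
    have IH: "if even x then lt (x + 2) (x + d) else lt (x + d) (x + 2)"
      using Suc.IH[OF eqs(3)] unfolding eqs(1,2) .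
    have 1: "lt x (x + d) \<longleftrightarrow> lt (x + 2 * d) (x + d)"
      using ap[of x "x + 2 * d" "x + d"] d by simp
    have 2: "lt (x + 2) (x + d) \<longleftrightarrow> lt (x + 2 * d - 2) (x + d)"
      using ap[of "x + 2" "x + 2 * d - 2" "x + d"] d by simp
    \<comment> \<open>The outermost steps of length 2 on the two sides are d - 1 places apart in the
      alternation, and d - 1 is even. If x lay on the other side of x + d than x + 2, these two
      steps would have opposite orientations.\<close>
    have 3: "lt (x + 2 * d) (x + 2 * d - 2) \<longleftrightarrow> lt (x + 2) x"
    proof -
      have "x + 2 * (d - 1) + 2 = x + 2 * d" "x + 2 * (d - 1) = x + 2 * d - 2" "even (d - 1)"
        using d(2) by (auto simp: d_def)
      then show ?thesis using alt[of x "d - 1"] d(1) by metis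
    qed
    have t: "lt a b \<longleftrightarrow> \<not> lt b a" if "a \<le> x + 2 * d" "b \<le> x + 2 * d" "a \<noteq> b" for a b
      using tot[of a b] that d by simp
    have "if even x then lt x (x + d) else lt (x + d) x"
    proof (cases "even x")
      case True
      have "lt x (x + d)"
      proof (rule ccontr)
        assume "\<not> lt x (x + d)"
        then have "lt (x + d) x" "lt (x + d) (x + 2 * d)" using 1 t[of x "x + d"] t[of "x + d" "x + 2 * d"] d by auto
        moreover have "lt (x + 2) (x + d)" "lt (x + 2 * d - 2) (x + d)" using IH 2 True by auto
        ultimately have "lt (x + 2) x" "lt (x + 2 * d - 2) (x + 2 * d)" using tr by blast+
        then show False using 3 t[of "x + 2 * d - 2" "x + 2 * d"] d by auto
      qed
      then show ?thesis using True by simp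
    next
      case False
      have "lt (x + d) x"
      proof (rule ccontr)
        assume "\<not> lt (x + d) x"
        then have "lt x (x + d)" "lt (x + 2 * d) (x + d)" using 1 t[of x "x + d"] d by auto
        moreover have "lt (x + d) (x + 2)" using IH False by simp
        moreover have "lt (x + d) (x + 2 * d - 2)"
          using calculation(3) 2 t[of "x + d" "x + 2"] t[of "x + d" "x + 2 * d - 2"] d by auto
        ultimately have "lt x (x + 2)" "lt (x + 2 * d) (x + 2 * d - 2)" using tr by blast+
        then show False using 3 t[of x "x + 2"] d by auto
      qed
      then show ?thesis using False by simp
    qed
    moreover have "2 * Suc k + 1 = d" by (simp add: d_def)
    ultimately show ?case by simp
  qed
  have up: "lt u (u + d)" if "u + 2 * d < n" "even u" "odd d" for u d
    using mid[of u "d div 2"] that by simp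
  have dn: "lt (u + d) u" if "u + 2 * d < n" "odd u" "odd d" for u d
    using mid[of u "d div 2"] that by simp
  have "x \<noteq> y" using xy by auto
  from xy(5) consider "x + 1 = y" | "y + 1 = x" | "x \<le> 2 * y" "2 * y < n + x" "x < y" | "x \<le> 2 * y" "2 * y < n + x" "y < x"
    | "y \<le> 2 * x" "2 * x < n + y" "x < y" | "y \<le> 2 * x" "2 * x < n + y" "y < x"
    using xy(1-4) \<open>x \<noteq> y\<close> unfolding near_def by (cases "x < y") (auto simp: mult_2)
  then show ?thesis
  proof cases
    case 1
    then show ?thesis using nb[of x] xy by force
  next
    case 2
    then show ?thesis using nb[of y] xy by force
  next
    case 3
    then show ?thesis using up[of x "y - x"] xy by auto
  next
    case 4
    \<comment> \<open>Here x is the upper end of the progression with middle y; its reflection 2y -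
      x is the lower end and is again even.\<close>
    have "lt (2 * y - x) y" using up[of "2 * y - x" "x - y"] 4 xy by auto
    then show ?thesis using ap[of "2 * y - x" x y] 4 xy by auto
  next
    case 5
    have "lt x (2 * x - y)" using dn[of "2 * x - y" "y - x"] 5 xy by auto
    then show ?thesis using ap[of "2 * x - y" y x] tot[of x y] tot[of x "2 * x - y"] 5 xy by auto
  next
    case 6
    then show ?thesis using dn[of y "x - y"] xy by auto
  qed
qed

section \<open>Interleavings of two parity classes\<close>

definition ordered :: "nat \<Rightarrow> nat \<Rightarrow> nat list \<Rightarrow> bool" where
  "ordered n q w \<longleftrightarrow>
     (\<forall>a\<in>set w. \<forall>b\<in>set w. a mod 2 = q \<longrightarrow> b mod 2 \<noteq> q \<longrightarrow> near (n - 1) a b \<longrightarrow> before w a b)"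

text \<open>The parity q goes first. The sets X and Y are arbitrary, so that the same operation also
  describes the remainders of words of which a prefix has been removed.\<close>

definition interleavings :: "nat \<Rightarrow> nat \<Rightarrow> nat list set \<Rightarrow> nat list set \<Rightarrow> nat list set" where
  "interleavings n q X Y = {w. distinct w \<and> set w \<subseteq> {..<n} \<and> half 0 w \<in> X \<and> half 1 w \<in> Y \<and> ordered n q w}"

lemma half_less: "2 * i < n \<longleftrightarrow> i < (n + 1) div 2" "2 * i + 1 < n \<longleftrightarrow> i < n div 2" for i n :: nat
  by presburger+

lemma set_eq_parity:
  assumes "set w \<subseteq> {..<n}"
  shows "set w = {..<n} \<longleftrightarrow> set (half 0 w) = {..<(n + 1) div 2} \<and> set (half 1 w) = {..<n div 2}"
proof
  assume s: "set w = {..<n}"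
  show "set (half 0 w) = {..<(n + 1) div 2} \<and> set (half 1 w) = {..<n div 2}"
    unfolding set_eq_iff using set_half[of 0 _ w] set_half[of 1 _ w] half_less unfolding s by simp
next
  assume *: "set (half 0 w) = {..<(n + 1) div 2} \<and> set (half 1 w) = {..<n div 2}"
  have "x \<in> set w" if "x < n" for x
  proof (cases "even x")
    case True
    then obtain i where "x = 2 * i" by blast
    then show ?thesis using set_half[of 0 i w] half_less(1)[of i n] * that by simp
  next
    case False
    then obtain i where "x = 2 * i + 1" by (rule oddE)
    then show ?thesis using set_half[of 1 i w] half_less(2)[of i n] * that by simp
  qed
  then show "set w = {..<n}" using assms by auto
qed

text \<open>The halves inherit the absence of progressions, and the order of 0 and 1 decides which
  parity goes first at all near pairs.\<close>

lemma free_perms_sub_interleavings: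
  assumes w: "w \<in> free_perms n" and n: "n \<ge> 2"
  shows "w \<in> interleavings n (if before w 0 1 then 0 else 1) (free_perms ((n + 1) div 2)) (free_perms (n div 2))"
proof -
  have d: "distinct w" and s: "set w = {..<n}"
    and ap: "\<And>a m z. a + z = 2 * m \<Longrightarrow> before w a m \<Longrightarrow> before w m z \<Longrightarrow> False"
    using w by (auto simp: free_perms_before)
  have pV: "half p w \<in> free_perms k" if "p < 2" "set (half p w) = {..<k}" for p k
    unfolding free_perms_before
  proof (intro conjI allI impI notI)
    fix a m z assume "a + z = 2 * m" "before (half p w) a m" "before (half p w) m z"
    then show False using ap[of "2 * a + p" "2 * z + p" "2 * m + p"] that by (simp add: before_half)
  qed (use that d distinct_half in auto)
  have half: "half 0 w \<in> free_perms ((n + 1) div 2)" "half 1 w \<in> free_perms (n div 2)"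
    using pV set_eq_parity[of w n] s by auto
  have tot: "before w a b \<longleftrightarrow> \<not> before w b a" if "a < n" "b < n" "a \<noteq> b" for a b
    using before_total[of a w b] before_asym[OF d] s that by auto
  have sym: "before w a m \<longleftrightarrow> before w z m" if "a < n" "z < n" "a \<noteq> z" "a + z = 2 * m" for a m z
    using ap[of a z m] ap[of z a m] tot[of a m] tot[of z m] that by (auto simp: add.commute)
  have h0: "before w a b" if "before w 0 1" "a < n" "b < n" "a mod 2 = 0" "b mod 2 \<noteq> 0" "near (n - 1) a b" for a b
  proof -
    have "even a" "odd b" using that(4,5) by (simp_all only: even_iff_mod_2_eq_zero not_False_eq_True)
    with that show ?thesis using even_before_near_odd[of n "before w" a b] tot before_trans[OF d] sym by blast
  qed
  \<comment> \<open>The mirror image of the previous case: the order lemma is applied to the word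
    read backwards, with b as the even and a as the odd letter.\<close>
  have h1: "before w a b" if "before w 1 0" "a < n" "b < n" "a mod 2 = 1" "b mod 2 \<noteq> 1" "near (n - 1) a b" for a b
  proof -
    have "odd a" "even b" using that(4,5) by (metis even_iff_mod_2_eq_zero odd_iff_mod_2_eq_one)+
    moreover have "near (n - 1) b a" using that(6) near_commute by blast
    moreover have "before w m a \<longleftrightarrow> before w m z" if "a < n" "z < n" "a \<noteq> z" "a + z = 2 * m" for a m z
      using sym[OF that] tot[of a m] tot[of z m] that by auto
    ultimately show ?thesis using that
      even_before_near_odd[of n "\<lambda>a b. before w b a" b a] tot before_trans[OF d] by blast
  qed
  have o: "(before w 0 1 \<longrightarrow> a mod 2 = 0 \<longrightarrow> b mod 2 \<noteq> 0 \<longrightarrow> before w a b) \<and> (before w 1 0 \<longrightarrow> a mod 2 = 1 \<longrightarrow> b mod 2 \<noteq> 1 \<longrightarrow> before w a b)"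
    if "a < n" "b < n" "near (n - 1) a b" for a b
    using that h0[of a b] h1[of a b] by simp
  have "before w 0 1 \<longleftrightarrow> \<not> before w 1 0" using tot[of 0 1] n by simp
  then show ?thesis
    using d s half o unfolding interleavings_def ordered_def by (cases "before w 0 1") simp_all
qed

text \<open>The ends of a progression have equal parity. If the middle shares it, the progression
  survives halving. Otherwise the middle is near both ends and therefore lies before both or after
  both.\<close>

lemma interleavings_sub_free_perms:
  assumes w: "w \<in> interleavings n q (free_perms ((n + 1) div 2)) (free_perms (n div 2))" and q: "q < 2"
  shows "w \<in> free_perms n"
proof -
  have d: "distinct w" and s: "set w \<subseteq> {..<n}" and p: "half 0 w \<in> free_perms ((n + 1) div 2)" "half 1 w \<in> free_perms (n div 2)"
    and o: "\<And>a b. a \<in> set w \<Longrightarrow> b \<in> set w \<Longrightarrow> a mod 2 = q \<Longrightarrow> b mod 2 \<noteq> q \<Longrightarrow> near (n - 1) a b \<Longrightarrow> before w a b"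
    using w by (auto simp: interleavings_def ordered_def)
  have "set w = {..<n}" using p set_eq_parity[OF s] by (simp add: free_perms_before)
  moreover have False if amz: "a + z = 2 * m" "before w a m" "before w m z" for a m z
  proof (cases "a mod 2 = m mod 2")
    case True
    define r where "r = m mod 2"
    have "even a \<longleftrightarrow> even z" using amz(1) by (metis dvd_triv_left even_add)
    then have "z mod 2 = m mod 2" using True by (simp add: mod2_eq_if)
    then have r: "a mod 2 = r" "m mod 2 = r" "z mod 2 = r" "r < 2" using True by (simp_all add: r_def)
    have *: "x = 2 * (x div 2) + r" if "x mod 2 = r" for x using mult_div_mod_eq[of 2 x] that by simp
    obtain a' m' z' where eqs: "a = 2 * a' + r" "m = 2 * m' + r" "z = 2 * z' + r"
      using *[OF r(1)] *[OF r(2)] *[OF r(3)] by blast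
    have "before (half r w) a' m'" "before (half r w) m' z'"
      using amz(2,3) unfolding eqs before_half[OF r(4)] by blast+
    moreover have "a' + z' = 2 * m'" using amz(1) unfolding eqs by arith
    moreover have "\<exists>k. half r w \<in> free_perms k" using p r(4) by (auto simp: less_2_cases_iff)
    ultimately show False unfolding free_perms_before by blast
  next
    case False
    have in_w: "a \<in> set w" "m \<in> set w" "z \<in> set w" using amz before_in_set by blast+
    then have "a < n" "m < n" "z < n" using s by auto
    then have nr: "near (n - 1) a m" "near (n - 1) m z" "near (n - 1) m a" "near (n - 1) z m"
      using amz(1) by (auto simp: near_def)
    have "even a \<longleftrightarrow> even z" using amz(1) by (metis dvd_triv_left even_add)
    then have z: "z mod 2 = a mod 2" by (simp add: mod2_eq_if)
    show False
    proof (cases "a mod 2 = q")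
      case True
      then have "before w z m" using o[of z m] in_w nr z False by simp
      then show False using amz(3) before_asym[OF d] by blast
    next
      case F: False
      then have "m mod 2 = q" using False q by (cases "even a"; cases "even m") (auto simp: mod2_eq_if less_2_cases_iff)
      then have "before w m a" using o[of m a] in_w nr F by simp
      then show False using amz(2) before_asym[OF d] by blast
    qed
  qed
  ultimately show ?thesis using d by (auto simp: free_perms_before)
qed

lemma free_perms_eq_interleavings:
  assumes "n \<ge> 2"
  shows "free_perms n = interleavings n 0 (free_perms ((n + 1) div 2)) (free_perms (n div 2)) \<union> interleavings n 1 (free_perms ((n + 1) div 2)) (free_perms (n div 2))"
proof (intro equalityI subsetI)
  fix w assume "w \<in> free_perms n"
  from free_perms_sub_interleavings[OF this assms]
  show "w \<in> interleavings n 0 (free_perms ((n + 1) div 2)) (free_perms (n div 2)) \<union> interleavings n 1 (free_perms ((n + 1) div 2)) (free_perms (n div 2))"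
    by (cases "before w 0 1") simp_all
next
  fix w assume "w \<in> interleavings n 0 (free_perms ((n + 1) div 2)) (free_perms (n div 2)) \<union> interleavings n 1 (free_perms ((n + 1) div 2)) (free_perms (n div 2))"
  then show "w \<in> free_perms n" using interleavings_sub_free_perms[of w n 0] interleavings_sub_free_perms[of w n 1] by auto
qed

text \<open>The neighbours 0 and 1 are near even for n = 2, where no progression contains both; so q
  can be read off from every such word, and the two kinds of interleavings are disjoint.\<close>

lemma interleavings_0_1_before:
  assumes "w \<in> interleavings n q (free_perms ((n + 1) div 2)) (free_perms (n div 2))" "q < 2" "n \<ge> 2"
  shows "before w 0 1 \<longleftrightarrow> q = 0"
proof -
  have "set w = {..<n}" "distinct w" using interleavings_sub_free_perms[OF assms(1,2)] by (auto simp: free_perms_before)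
  moreover have "near (n - 1) 0 1" "near (n - 1) 1 0" by (auto simp: near_def)
  ultimately have "q = 0 \<Longrightarrow> before w 0 1" "q = 1 \<Longrightarrow> before w 1 0"
    using assms(1,3) by (auto simp: interleavings_def ordered_def)
  then show ?thesis using assms(2) before_asym[OF \<open>distinct w\<close>] by (auto simp: less_2_cases_iff)
qed

lemma finite_free_perms: "finite (free_perms n)"
  by (rule finite_subset[of _ "permutations_of_set {..<n}"]) (auto simp: free_perms_def intro: permutations_of_setI)

text \<open>Reversal exchanges the parity that goes first. It is the bijection behind the factor 2
  in \<open>card_free_perms\<close>.\<close>

lemma rev_interleavings:
  assumes "w \<in> interleavings n q (free_perms a) (free_perms b)" "q < 2"
  shows "rev w \<in> interleavings n (1 - q) (free_perms a) (free_perms b)"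
proof -
  have w: "distinct w" "set w \<subseteq> {..<n}" "half 0 w \<in> free_perms a" "half 1 w \<in> free_perms b"
    and o: "\<And>a b. a \<in> set w \<Longrightarrow> b \<in> set w \<Longrightarrow> a mod 2 = q \<Longrightarrow> b mod 2 \<noteq> q \<Longrightarrow> near (n - 1) a b \<Longrightarrow> before w a b"
    using assms by (auto simp: interleavings_def ordered_def)
  have "before (rev w) a b" if "a \<in> set w" "b \<in> set w" "a mod 2 = 1 - q" "b mod 2 \<noteq> 1 - q" "near (n - 1) a b" for a b
  proof -
    have "b mod 2 = q" "a mod 2 \<noteq> q" using that(3,4) assms(2)
      by (cases "even a"; cases "even b"; auto simp: mod2_eq_if less_2_cases_iff)+
    then show ?thesis using o[of b a] that near_commute by (simp add: before_rev)
  qed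
  then show ?thesis using w by (simp add: interleavings_def ordered_def half_rev rev_in_free_perms)
qed

lemma card_free_perms:
  assumes "n \<ge> 2"
  shows "card (free_perms n) = 2 * card (interleavings n 0 (free_perms ((n + 1) div 2)) (free_perms (n div 2)))" (is "_ = 2 * card ?E")
proof -
  let ?O = "interleavings n 1 (free_perms ((n + 1) div 2)) (free_perms (n div 2))"
  have "?E \<inter> ?O = {}"
    using interleavings_0_1_before[of _ n 0] interleavings_0_1_before[of _ n 1] assms by fastforce
  moreover have "finite ?E" "finite ?O" using free_perms_eq_interleavings[OF assms] finite_free_perms[of n] by (auto intro: finite_subset)
  moreover have "?O = rev ` ?E"
    using rev_interleavings[of _ n 0] rev_interleavings[of _ n 1] by (force intro: image_eqI[of _ rev "rev _"])
  then have "card ?O = card ?E" by (simp add: card_image inj_on_def)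
  ultimately show ?thesis using free_perms_eq_interleavings[OF assms] by (simp add: card_Un_disjoint)
qed

section \<open>Typed states\<close>

text \<open>A state records the letters used so far. \<open>EO A B\<close> combines states of the halved even and odd letters, in a word where even
  letters precede the odd letters near them; in \<open>OE A B\<close> the odd letters come first. \<open>completions n S\<close> are the words in the
  letters not yet used.\<close>

datatype state = Fresh | Done | EO state state | OE state state

fun completions :: "nat \<Rightarrow> state \<Rightarrow> nat list set" where
  "completions n Fresh = free_perms n"
| "completions n Done = {[]}"
| "completions n (EO A B) = interleavings n 0 (completions ((n + 1) div 2) A) (completions (n div 2) B)"
| "completions n (OE A B) = interleavings n 1 (completions ((n + 1) div 2) A) (completions (n div 2) B)"

fun missing :: "nat \<Rightarrow> state \<Rightarrow> nat set" where
  "missing n Fresh = {..<n}"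
| "missing n Done = {}"
| "missing n (EO A B) = {x. x < n \<and> x div 2 \<in> (if even x then missing ((n + 1) div 2) A else missing (n div 2) B)}"
| "missing n (OE A B) = {x. x < n \<and> x div 2 \<in> (if even x then missing ((n + 1) div 2) A else missing (n div 2) B)}"

text \<open>Excluding \<open>EO Done Done\<close> and \<open>OE Done Done\<close> gives the
  exhausted state the unique form \<open>Done\<close>; \<open>eo\<close> and \<open>oe\<close> below
  restore this form after a move.\<close>

fun wf_state :: "nat \<Rightarrow> state \<Rightarrow> bool" where
  "wf_state n Fresh \<longleftrightarrow> n \<ge> 1"
| "wf_state n Done \<longleftrightarrow> n \<ge> 1"
| "wf_state n (EO A B) \<longleftrightarrow> n \<ge> 2 \<and> wf_state ((n + 1) div 2) A \<and> wf_state (n div 2) B \<and> (A = Done \<longrightarrow> B \<noteq> Done)"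
| "wf_state n (OE A B) \<longleftrightarrow> n \<ge> 2 \<and> wf_state ((n + 1) div 2) A \<and> wf_state (n div 2) B \<and> (A = Done \<longrightarrow> B \<noteq> Done)"

lemma missing_less: "x \<in> missing n S \<Longrightarrow> x < n"
  by (cases S) auto

lemma interleavings_set:
  assumes "w \<in> interleavings n q X Y" "\<And>w. w \<in> X \<Longrightarrow> set w = M" "\<And>w. w \<in> Y \<Longrightarrow> set w = N"
  shows "set w = {x. x < n \<and> x div 2 \<in> (if even x then M else N)}"
proof -
  have "set (half 0 w) = M" "set (half 1 w) = N" using assms by (auto simp: interleavings_def)
  moreover have "set w \<subseteq> {..<n}" using assms by (auto simp: interleavings_def)
  moreover have "x \<in> set w \<longleftrightarrow> x div 2 \<in> set (half (x mod 2) w)" for x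
    by (subst set_half) auto
  ultimately show ?thesis by (auto simp: mod2_eq_if)
qed

lemma completions_set: "w \<in> completions n S \<Longrightarrow> set w = missing n S"
proof (induction S arbitrary: n w)
  case (EO A B)
  then show ?case using interleavings_set[of w n 0] by simp
next
  case (OE A B)
  then show ?case using interleavings_set[of w n 1] by simp
qed (auto simp: free_perms_before)

lemma completions_distinct: "w \<in> completions n S \<Longrightarrow> distinct w"
  by (cases S) (auto simp: free_perms_before interleavings_def)

lemma finite_completions: "finite (completions n S)"
proof (rule finite_subset)
  show "completions n S \<subseteq> {w. set w \<subseteq> {..<n} \<and> length w \<le> n}"
  proof
    fix w assume w: "w \<in> completions n S"
    have "set w \<subseteq> {..<n}" using completions_set[OF w] missing_less by auto
    moreover from this have "length w \<le> n"
      using card_mono[of "{..<n}" "set w"] distinct_card[OF completions_distinct[OF w]] by simp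
    ultimately show "w \<in> {w. set w \<subseteq> {..<n} \<and> length w \<le> n}" by simp
  qed
qed (simp add: finite_lists_length_le)

text \<open>Consequently the empty word completes no well-formed state except \<open>Done\<close>,
  and every completion of another state has a first letter.\<close>

lemma missing_nonempty: "wf_state n S \<Longrightarrow> S \<noteq> Done \<Longrightarrow> missing n S \<noteq> {}"
proof (induction S arbitrary: n)
  case Fresh
  then show ?case by (auto simp: lessThan_empty_iff)
next
  case (EO A B)
  show ?case
  proof (cases "A = Done")
    case True
    then obtain y where "y \<in> missing (n div 2) B" using EO.IH(2)[of "n div 2"] EO.prems by auto
    moreover from this have "y < n div 2" by (rule missing_less)
    ultimately have "2 * y + 1 \<in> missing n (EO A B)" by auto
    then show ?thesis by blast
  next
    case False
    then obtain x where "x \<in> missing ((n + 1) div 2) A" using EO.IH(1)[of "(n + 1) div 2"] EO.prems by auto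
    moreover from this have "x < (n + 1) div 2" by (rule missing_less)
    ultimately have "2 * x \<in> missing n (EO A B)" by auto
    then show ?thesis by blast
  qed
next
  case (OE A B)
  show ?case
  proof (cases "A = Done")
    case True
    then obtain y where "y \<in> missing (n div 2) B" using OE.IH(2)[of "n div 2"] OE.prems by auto
    moreover from this have "y < n div 2" by (rule missing_less)
    ultimately have "2 * y + 1 \<in> missing n (OE A B)" by auto
    then show ?thesis by blast
  next
    case False
    then obtain x where "x \<in> missing ((n + 1) div 2) A" using OE.IH(1)[of "(n + 1) div 2"] OE.prems by auto
    moreover from this have "x < (n + 1) div 2" by (rule missing_less)
    ultimately have "2 * x \<in> missing n (OE A B)" by auto
    then show ?thesis by blast
  qed
qed simp

text \<open>The letter x can come first if it can do so in its own class and, when that class goes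
  second, no remaining letter of the other class is near x. M and N are the remaining halved even
  and odd letters.\<close>

lemma Cons_in_interleavings:
  assumes dX: "\<And>u. u \<in> X \<Longrightarrow> distinct u" and dY: "\<And>u. u \<in> Y \<Longrightarrow> distinct u"
    and mX: "\<And>u. u \<in> X \<Longrightarrow> set u = M" and mY: "\<And>u. u \<in> Y \<Longrightarrow> set u = N" and q: "q < 2"
  shows "x # w \<in> interleavings n q X Y \<longleftrightarrow> x < n \<and>
    (if even x
     then w \<in> interleavings n q {u. x div 2 # u \<in> X} Y \<and> (q = 1 \<longrightarrow> (\<forall>y\<in>N. 2 * y + 1 < n \<longrightarrow> \<not> near (n - 1) (2 * y + 1) x))
     else w \<in> interleavings n q X {u. x div 2 # u \<in> Y} \<and> (q = 0 \<longrightarrow> (\<forall>y\<in>M. 2 * y < n \<longrightarrow> \<not> near (n - 1) (2 * y) x)))"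
  (is "?l \<longleftrightarrow> x < n \<and> ?r")
proof -
  \<comment> \<open>Nothing precedes the first letter x, so a constraint that puts a remaining
    letter before x cannot be met, while one that puts x first holds at once.\<close>
  have ord: "ordered n q (x # w) \<longleftrightarrow> ordered n q w \<and> (x mod 2 \<noteq> q \<longrightarrow> (\<forall>a\<in>set w. a mod 2 = q \<longrightarrow> \<not> near (n - 1) a x))"
    if "x \<notin> set w"
    unfolding ordered_def using that by (auto dest: before_in_set)
  show ?thesis
  proof (cases "even x")
    case True
    have nin: "x \<notin> set w" if "x div 2 # half 0 w \<in> X"
      using dX[OF that] set_half[of 0 "x div 2" w] True by simp
    have odds: "(\<forall>a\<in>set w. a mod 2 = 1 \<longrightarrow> \<not> near (n - 1) a x) \<longleftrightarrow> (\<forall>y\<in>N. 2 * y + 1 < n \<longrightarrow> \<not> near (n - 1) (2 * y + 1) x)"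
      if "half 1 w \<in> Y" "set w \<subseteq> {..<n}"
    proof -
      have N: "y \<in> N \<longleftrightarrow> 2 * y + 1 \<in> set w" for y using mY[OF that(1)] set_half[of 1 y w] by simp
      show ?thesis
      proof (intro iffI ballI impI)
        fix y assume "\<forall>a\<in>set w. a mod 2 = 1 \<longrightarrow> \<not> near (n - 1) a x" "y \<in> N"
        then show "\<not> near (n - 1) (2 * y + 1) x" using N by auto
      next
        fix a assume *: "\<forall>y\<in>N. 2 * y + 1 < n \<longrightarrow> \<not> near (n - 1) (2 * y + 1) x" "a \<in> set w" "a mod 2 = 1"
        have "a = 2 * (a div 2) + 1" using *(3) mult_div_mod_eq[of 2 a] by simp
        then show "\<not> near (n - 1) a x" using * N[of "a div 2"] that(2) by fastforce
      qed
    qed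
    have x: "x mod 2 = 0" "0 \<noteq> q \<longleftrightarrow> q = 1" using True q by auto
    have "?l \<longleftrightarrow> x < n \<and> x \<notin> set w \<and> distinct w \<and> set w \<subseteq> {..<n} \<and> x div 2 # half 0 w \<in> X \<and> half 1 w \<in> Y \<and> ordered n q (x # w)"
      by (auto simp: interleavings_def x(1))
    also have "\<dots> \<longleftrightarrow> x < n \<and> w \<in> interleavings n q {u. x div 2 # u \<in> X} Y \<and>
        (q = 1 \<longrightarrow> (\<forall>y\<in>N. 2 * y + 1 < n \<longrightarrow> \<not> near (n - 1) (2 * y + 1) x))"
      unfolding interleavings_def mem_Collect_eq using nin ord odds x by metis
    finally show ?thesis using True by simp
  next
    case False
    have nin: "x \<notin> set w" if "x div 2 # half 1 w \<in> Y"
      using dY[OF that] set_half[of 1 "x div 2" w] False by simp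
    have evens: "(\<forall>a\<in>set w. a mod 2 = 0 \<longrightarrow> \<not> near (n - 1) a x) \<longleftrightarrow> (\<forall>y\<in>M. 2 * y < n \<longrightarrow> \<not> near (n - 1) (2 * y) x)"
      if "half 0 w \<in> X" "set w \<subseteq> {..<n}"
    proof -
      have M: "y \<in> M \<longleftrightarrow> 2 * y \<in> set w" for y using mX[OF that(1)] set_half[of 0 y w] by simp
      show ?thesis
      proof (intro iffI ballI impI)
        fix y assume "\<forall>a\<in>set w. a mod 2 = 0 \<longrightarrow> \<not> near (n - 1) a x" "y \<in> M"
        then show "\<not> near (n - 1) (2 * y) x" using M by auto
      next
        fix a assume *: "\<forall>y\<in>M. 2 * y < n \<longrightarrow> \<not> near (n - 1) (2 * y) x" "a \<in> set w" "a mod 2 = 0"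
        have "a = 2 * (a div 2)" using *(3) mult_div_mod_eq[of 2 a] by simp
        then show "\<not> near (n - 1) a x" using * M[of "a div 2"] that(2) by fastforce
      qed
    qed
    have x: "x mod 2 = 1" "1 \<noteq> q \<longleftrightarrow> q = 0" using False q by (auto simp: mod2_eq_if)
    have "?l \<longleftrightarrow> x < n \<and> x \<notin> set w \<and> distinct w \<and> set w \<subseteq> {..<n} \<and> half 0 w \<in> X \<and> x div 2 # half 1 w \<in> Y \<and> ordered n q (x # w)"
      by (auto simp: interleavings_def x(1))
    also have "\<dots> \<longleftrightarrow> x < n \<and> w \<in> interleavings n q X {u. x div 2 # u \<in> Y} \<and>
        (q = 0 \<longrightarrow> (\<forall>y\<in>M. 2 * y < n \<longrightarrow> \<not> near (n - 1) (2 * y) x))"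
      unfolding interleavings_def mem_Collect_eq using nin ord evens x by metis
    finally show ?thesis using False by simp
  qed
qed

section \<open>Moves between states\<close>

text \<open>A set of naturals as a binary tree over the digits, lowest digit first, so that passing
  to the even or odd letters is taking a subtree.\<close>

datatype mask = No | Yes | Split mask mask

fun mem :: "mask \<Rightarrow> nat \<Rightarrow> bool" where
  "mem No x \<longleftrightarrow> False"
| "mem Yes x \<longleftrightarrow> True"
| "mem (Split a b) x \<longleftrightarrow> mem (if even x then a else b) (x div 2)"

text \<open>Equal constant halves are collapsed, so that an intersection that becomes empty shows up
  as \<open>No\<close> and can cut off a whole branch of the search.\<close>

fun split :: "mask \<Rightarrow> mask \<Rightarrow> mask" where
  "split No No = No"
| "split Yes Yes = Yes"
| "split No Yes = Split No Yes"
| "split Yes No = Split Yes No"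
| "split (Split a b) c = Split (Split a b) c"
| "split No (Split a b) = Split No (Split a b)"
| "split Yes (Split a b) = Split Yes (Split a b)"

lemma mem_split: "mem (split a b) x \<longleftrightarrow> mem (if even x then a else b) (x div 2)"
  by (cases "(a, b)" rule: split.cases) auto

fun meet :: "mask \<Rightarrow> mask \<Rightarrow> mask" where
  "meet No k = No"
| "meet Yes k = k"
| "meet (Split a b) No = No"
| "meet (Split a b) Yes = Split a b"
| "meet (Split a b) (Split c d) = split (meet a c) (meet b d)"

lemma mem_meet: "mem (meet a b) x \<longleftrightarrow> mem a x \<and> mem b x"
  by (induction a b arbitrary: x rule: meet.induct) (auto simp: mem_split)

fun left :: "mask \<Rightarrow> mask" and right :: "mask \<Rightarrow> mask" where
  "left No = No" | "left Yes = Yes" | "left (Split a b) = a"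
| "right No = No" | "right Yes = Yes" | "right (Split a b) = b"

lemma mem_left: "mem (left k) x \<longleftrightarrow> mem k (2 * x)" and mem_right: "mem (right k) x \<longleftrightarrow> mem k (2 * x + 1)"
  by (cases k; simp)+

text \<open>A tree of masks, indexed by the binary digits of x with the lowest digit first; an inner node caches the intersection of
  all masks below it.\<close>

datatype mtree = Leaf mask | Node mask mtree mtree

fun cached :: "mtree \<Rightarrow> mask" where
  "cached (Leaf k) = k"
| "cached (Node k l r) = k"

fun leaf :: "mtree \<Rightarrow> nat \<Rightarrow> mask" where
  "leaf (Leaf k) x = k"
| "leaf (Node k l r) x = leaf (if even x then l else r) (x div 2)"

fun tree_ok :: "nat \<Rightarrow> mtree \<Rightarrow> bool" where
  "tree_ok m (Leaf k) \<longleftrightarrow> m = 1"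
| "tree_ok m (Node k l r) \<longleftrightarrow>
     m \<ge> 2 \<and> tree_ok ((m + 1) div 2) l \<and> tree_ok (m div 2) r \<and> k = meet (cached l) (cached r)"

lemma ball_less_parity:
  "(\<forall>x<m. P x) \<longleftrightarrow> (\<forall>x<(m + 1) div 2. P (2 * x)) \<and> (\<forall>x<m div 2. P (2 * x + 1))" for P :: "nat \<Rightarrow> bool"
proof (intro iffI conjI allI impI)
  fix x assume *: "(\<forall>x<(m + 1) div 2. P (2 * x)) \<and> (\<forall>x<m div 2. P (2 * x + 1))" "x < m"
  show "P x"
  proof (cases "even x")
    case True
    then obtain i where "x = 2 * i" by blast
    then show ?thesis using * half_less(1)[of i m] by simp
  next
    case False
    then obtain i where "x = 2 * i + 1" by (rule oddE)
    then show ?thesis using * half_less(2)[of i m] by simp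
  qed
next
  fix x assume "\<forall>x<m. P x" "x < (m + 1) div 2"
  then show "P (2 * x)" using half_less(1)[of x m] by simp
next
  fix x assume "\<forall>x<m. P x" "x < m div 2"
  then show "P (2 * x + 1)" using half_less(2)[of x m] by simp
qed

lemma ball_missing_less: "(\<forall>x\<in>missing m S. P x) \<longleftrightarrow> (\<forall>x<m. x \<in> missing m S \<longrightarrow> P x)"
  using missing_less by blast

lemma mem_cached: "tree_ok m p \<Longrightarrow> mem (cached p) y \<longleftrightarrow> (\<forall>x<m. mem (leaf p x) y)"
proof (induction p arbitrary: m)
  case (Node k l r)
  then show ?case
    by (subst ball_less_parity) (auto simp: mem_meet)
qed auto

text \<open>The intersection of the masks at the letters missing in the state. \<open>Done\<close>
  gives the empty intersection, and at \<open>Fresh\<close> the cached mask saves the descent. A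
  compound state at a \<open>Leaf\<close> does not occur for matching sizes; \<open>No\<close> is a
  default there.\<close>

fun allowed :: "state \<Rightarrow> mtree \<Rightarrow> mask" where
  "allowed Done p = Yes"
| "allowed Fresh p = cached p"
| "allowed (EO a b) (Leaf k) = No"
| "allowed (OE a b) (Leaf k) = No"
| "allowed (EO a b) (Node k l r) = meet (allowed a l) (allowed b r)"
| "allowed (OE a b) (Node k l r) = meet (allowed a l) (allowed b r)"

lemma mem_allowed:
  "tree_ok m p \<Longrightarrow> wf_state m S \<Longrightarrow> mem (allowed S p) y \<longleftrightarrow> (\<forall>x\<in>missing m S. mem (leaf p x) y)"
proof (induction S p arbitrary: m rule: allowed.induct)
  case (5 a b k l r)
  have "mem (allowed a l) y \<longleftrightarrow> (\<forall>x\<in>missing ((m + 1) div 2) a. mem (leaf l x) y)"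
    by (rule 5(1)) (use 5(3,4) in simp_all)
  moreover have "mem (allowed b r) y \<longleftrightarrow> (\<forall>x\<in>missing (m div 2) b. mem (leaf r x) y)"
    by (rule 5(2)) (use 5(3,4) in simp_all)
  ultimately have "mem (allowed (EO a b) (Node k l r)) y \<longleftrightarrow>
      (\<forall>x<(m + 1) div 2. x \<in> missing ((m + 1) div 2) a \<longrightarrow> mem (leaf l x) y) \<and> (\<forall>x<m div 2. x \<in> missing (m div 2) b \<longrightarrow> mem (leaf r x) y)"
    by (simp only: ball_missing_less mem_meet allowed.simps)
  also have "\<dots> \<longleftrightarrow> (\<forall>x\<in>missing m (EO a b). mem (leaf (Node k l r) x) y)"
    unfolding ball_missing_less by (subst (3) ball_less_parity) (use half_less[of _ m] in auto)
  finally show ?case .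
next
  case (6 a b k l r)
  have "mem (allowed a l) y \<longleftrightarrow> (\<forall>x\<in>missing ((m + 1) div 2) a. mem (leaf l x) y)"
    by (rule 6(1)) (use 6(3,4) in simp_all)
  moreover have "mem (allowed b r) y \<longleftrightarrow> (\<forall>x\<in>missing (m div 2) b. mem (leaf r x) y)"
    by (rule 6(2)) (use 6(3,4) in simp_all)
  ultimately have "mem (allowed (OE a b) (Node k l r)) y \<longleftrightarrow>
      (\<forall>x<(m + 1) div 2. x \<in> missing ((m + 1) div 2) a \<longrightarrow> mem (leaf l x) y) \<and> (\<forall>x<m div 2. x \<in> missing (m div 2) b \<longrightarrow> mem (leaf r x) y)"
    by (simp only: ball_missing_less mem_meet allowed.simps)
  also have "\<dots> \<longleftrightarrow> (\<forall>x\<in>missing m (OE a b). mem (leaf (Node k l r) x) y)"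
    unfolding ball_missing_less by (subst (3) ball_less_parity) (use half_less[of _ m] in auto)
  finally show ?case .
qed (auto simp: mem_cached)

section \<open>Successor states of a typed state\<close>

text \<open>The combinatorial data for n letters: the same for the even and for the odd letters, and for every even (odd) letter
  the mask of odd (even) letters that are not near it.\<close>

datatype plan = Single | Halves plan plan mtree mtree

fun plan_ok :: "nat \<Rightarrow> plan \<Rightarrow> bool" where
  "plan_ok n Single \<longleftrightarrow> n = 1"
| "plan_ok n (Halves a b p q) \<longleftrightarrow> n \<ge> 2 \<and> plan_ok ((n + 1) div 2) a \<and> plan_ok (n div 2) b \<and>
     tree_ok ((n + 1) div 2) p \<and> tree_ok (n div 2) q \<and>
     (\<forall>x<(n + 1) div 2. \<forall>y<n div 2. (mem (leaf p x) y \<longleftrightarrow> \<not> near (n - 1) (2 * x) (2 * y + 1)) \<and>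
        (mem (leaf q y) x \<longleftrightarrow> \<not> near (n - 1) (2 * x) (2 * y + 1)))"

definition eo :: "state \<Rightarrow> state \<Rightarrow> state" where
  "eo a b = (if a = Done \<and> b = Done then Done else EO a b)"

definition oe :: "state \<Rightarrow> state \<Rightarrow> state" where
  "oe a b = (if a = Done \<and> b = Done then Done else OE a b)"

text \<open>The mask k holds the letters that the surrounding states permit. The class that goes
  second is restricted further by \<open>allowed\<close>, applied to the class that goes first. From
  \<open>Fresh\<close> the parity of the first letter fixes the type, while the other class stays
  \<open>Fresh\<close>.\<close>

fun moves :: "mask \<Rightarrow> state \<Rightarrow> plan \<Rightarrow> (nat \<times> state) list" where
  "moves k s Single = (if mem k 0 \<and> s = Fresh then [(0, Done)] else [])"
| "moves k s (Halves a b p q) = (case s of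
     Done \<Rightarrow> []
   | Fresh \<Rightarrow> map (\<lambda>(x, t). (2 * x, EO t Fresh)) (moves (left k) Fresh a) @
       map (\<lambda>(y, t). (2 * y + 1, OE Fresh t)) (moves (right k) Fresh b)
   | EO u v \<Rightarrow> map (\<lambda>(x, t). (2 * x, eo t v)) (moves (left k) u a) @
       map (\<lambda>(y, t). (2 * y + 1, eo u t)) (moves (meet (right k) (allowed u p)) v b)
   | OE u v \<Rightarrow> map (\<lambda>(x, t). (2 * x, oe t v)) (moves (meet (left k) (allowed v q)) u a) @
       map (\<lambda>(y, t). (2 * y + 1, oe u t)) (moves (right k) v b))"

lemma free_perms_1: "free_perms 1 = {[0]}"
proof -
  have "w = [0]" if "distinct w" "set w = {..<1}" for w :: "nat list"
    using that by (cases w; cases "tl w") (auto simp: lessThan_Suc)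
  then show ?thesis by (auto simp: free_perms_def three_free_def)
qed

lemma interleavings_Nil: "interleavings n q {[]} {[]} = {[]}"
proof (intro equalityI subsetI)
  fix w assume "w \<in> interleavings n q {[]} {[]}"
  then have "half 0 w = []" "half 1 w = []" by (auto simp: interleavings_def)
  then have "x \<notin> set w" for x
    by (cases "even x") (auto simp: half_def filter_empty_conv mod2_eq_if)
  then show "w \<in> {[]}" by (cases w) auto
qed (auto simp: interleavings_def ordered_def)

lemma completions_eo: "completions n (eo A B) = interleavings n 0 (completions ((n + 1) div 2) A) (completions (n div 2) B)"
  by (simp add: eo_def interleavings_Nil)

lemma completions_oe: "completions n (oe A B) = interleavings n 1 (completions ((n + 1) div 2) A) (completions (n div 2) B)"
  by (simp add: oe_def interleavings_Nil)

text \<open>Every letter is near some letter of the other parity. Hence a word on all letters can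
  begin only in the class that goes first.\<close>

lemma near_exists:
  assumes "n \<ge> 2"
  shows "i < (n + 1) div 2 \<Longrightarrow> \<exists>y<n div 2. near (n - 1) (2 * i) (2 * y + 1)"
    and "i < n div 2 \<Longrightarrow> \<exists>y<(n + 1) div 2. near (n - 1) (2 * y) (2 * i + 1)"
proof -
  assume i: "i < (n + 1) div 2"
  show "\<exists>y<n div 2. near (n - 1) (2 * i) (2 * y + 1)"
  proof (cases "i = 0")
    case True
    then show ?thesis using assms by (intro exI[of _ 0]) (auto simp: near_def)
  next
    case False
    then show ?thesis using i by (intro exI[of _ "i - 1"]) (auto simp: near_def)
  qed
next
  assume "i < n div 2"
  then show "\<exists>y<(n + 1) div 2. near (n - 1) (2 * y) (2 * i + 1)"
    by (intro exI[of _ i]) (auto simp: near_def)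
qed

text \<open>The induction step of \<open>moves_correct\<close> for one compound state. LA and LB
  stand for the moves of the two halves under the masks kA and kB, which already include the
  restriction on the class that goes second.\<close>

lemma Cons_in_interleavings_moves:
  fixes LA LB :: "(nat \<times> state) list"
  defines "na \<equiv> \<lambda>n. (n + 1) div (2::nat)" and "nb \<equiv> \<lambda>n. n div (2::nat)"
  assumes A: "\<And>i w. i # w \<in> completions (na n) u \<and> mem kA i \<longleftrightarrow> (\<exists>t. (i, t) \<in> set LA \<and> w \<in> completions (na n) t)"
    and B: "\<And>i w. i # w \<in> completions (nb n) v \<and> mem kB i \<longleftrightarrow> (\<exists>t. (i, t) \<in> set LB \<and> w \<in> completions (nb n) t)"
    and kA: "\<And>i. i < na n \<Longrightarrow> mem kA i \<longleftrightarrow>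
      mem k (2 * i) \<and> (q = 1 \<longrightarrow> (\<forall>y\<in>missing (nb n) v. \<not> near (n - 1) (2 * i) (2 * y + 1)))"
    and kB: "\<And>i. i < nb n \<Longrightarrow> mem kB i \<longleftrightarrow>
      mem k (2 * i + 1) \<and> (q = 0 \<longrightarrow> (\<forall>y\<in>missing (na n) u. \<not> near (n - 1) (2 * y) (2 * i + 1)))"
    and q: "q < 2"
  shows "x # w \<in> interleavings n q (completions (na n) u) (completions (nb n) v) \<and> mem k x \<longleftrightarrow>
    (\<exists>i t. x = 2 * i \<and> (i, t) \<in> set LA \<and> w \<in> interleavings n q (completions (na n) t) (completions (nb n) v)) \<or>
    (\<exists>i t. x = 2 * i + 1 \<and> (i, t) \<in> set LB \<and> w \<in> interleavings n q (completions (na n) u) (completions (nb n) t))"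
proof -
  have C: "x # w \<in> interleavings n q (completions (na n) u) (completions (nb n) v) \<longleftrightarrow> x < n \<and>
    (if even x
     then w \<in> interleavings n q {t. x div 2 # t \<in> completions (na n) u} (completions (nb n) v) \<and>
       (q = 1 \<longrightarrow> (\<forall>y\<in>missing (nb n) v. 2 * y + 1 < n \<longrightarrow> \<not> near (n - 1) (2 * y + 1) x))
     else w \<in> interleavings n q (completions (na n) u) {t. x div 2 # t \<in> completions (nb n) v} \<and>
       (q = 0 \<longrightarrow> (\<forall>y\<in>missing (na n) u. 2 * y < n \<longrightarrow> \<not> near (n - 1) (2 * y) x)))"
    by (rule Cons_in_interleavings) (use completions_distinct completions_set q in blast)+
  have sA: "2 * y < n" if "y \<in> missing (na n) u" for y
    using missing_less[OF that] half_less(1) by (simp add: na_def)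
  have sB: "2 * y + 1 < n" if "y \<in> missing (nb n) v" for y
    using missing_less[OF that] half_less(2) by (simp add: nb_def)
  show ?thesis
  proof (cases "even x")
    case True
    then obtain i where x: "x = 2 * i" by blast
    have 1: "x < n \<longleftrightarrow> i < na n" using half_less(1) by (simp add: x na_def)
    have "x # w \<in> interleavings n q (completions (na n) u) (completions (nb n) v) \<and> mem k x \<longleftrightarrow>
        i < na n \<and> mem kA i \<and> w \<in> interleavings n q {t. i # t \<in> completions (na n) u} (completions (nb n) v)"
      unfolding C 1 using kA[of i] sB near_commute by (auto simp: x)
    also have "\<dots> \<longleftrightarrow> i < na n \<and> (\<exists>t. (i, t) \<in> set LA \<and> w \<in> interleavings n q (completions (na n) t) (completions (nb n) v))"
      using A[of i "half 0 w"] unfolding interleavings_def by auto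
    also have "\<dots> \<longleftrightarrow> (\<exists>t. (i, t) \<in> set LA \<and> w \<in> interleavings n q (completions (na n) t) (completions (nb n) v))"
    proof -
      have "i < na n" if "(i, t) \<in> set LA" "w \<in> interleavings n q (completions (na n) t) (completions (nb n) v)" for t
      proof -
        have "i # half 0 w \<in> completions (na n) u" using A[of i "half 0 w"] that by (auto simp: interleavings_def)
        then show ?thesis using completions_set missing_less by (metis list.set_intros(1))
      qed
      then show ?thesis by blast
    qed
    finally have "x # w \<in> interleavings n q (completions (na n) u) (completions (nb n) v) \<and> mem k x \<longleftrightarrow> \<dots>" .
    moreover have "x \<noteq> 2 * j + 1" "x = 2 * j \<longleftrightarrow> i = j" for j using x by presburger+
    ultimately show ?thesis by simp
  next
    case False
    then obtain i where x: "x = 2 * i + 1" by (rule oddE)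
    have 1: "x < n \<longleftrightarrow> i < nb n" using half_less(2) by (simp add: x nb_def)
    have "x # w \<in> interleavings n q (completions (na n) u) (completions (nb n) v) \<and> mem k x \<longleftrightarrow>
        i < nb n \<and> mem kB i \<and> w \<in> interleavings n q (completions (na n) u) {t. i # t \<in> completions (nb n) v}"
      unfolding C 1 using kB[of i] sA by (auto simp: x)
    also have "\<dots> \<longleftrightarrow> i < nb n \<and> (\<exists>t. (i, t) \<in> set LB \<and> w \<in> interleavings n q (completions (na n) u) (completions (nb n) t))"
      using B[of i "half 1 w"] unfolding interleavings_def by auto
    also have "\<dots> \<longleftrightarrow> (\<exists>t. (i, t) \<in> set LB \<and> w \<in> interleavings n q (completions (na n) u) (completions (nb n) t))"
    proof -
      have "i < nb n" if "(i, t) \<in> set LB" "w \<in> interleavings n q (completions (na n) u) (completions (nb n) t)" for t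
      proof -
        have "i # half 1 w \<in> completions (nb n) v" using B[of i "half 1 w"] that by (auto simp: interleavings_def)
        then show ?thesis using completions_set missing_less by (metis list.set_intros(1))
      qed
      then show ?thesis by blast
    qed
    finally have "x # w \<in> interleavings n q (completions (na n) u) (completions (nb n) v) \<and> mem k x \<longleftrightarrow> \<dots>" .
    moreover have "x \<noteq> 2 * j" "x = 2 * j + 1 \<longleftrightarrow> i = j" for j using x by presburger+
    ultimately show ?thesis by simp
  qed
qed

lemma ex_in_set_parity_maps:
  "(\<exists>t. (x :: nat, t) \<in> set (map (\<lambda>(x, t). (2 * x, f t)) L @ map (\<lambda>(y, t). (2 * y + 1, g t)) M) \<and> Q t) \<longleftrightarrow>
    (\<exists>i t. x = 2 * i \<and> (i, t) \<in> set L \<and> Q (f t)) \<or> (\<exists>i t. x = 2 * i + 1 \<and> (i, t) \<in> set M \<and> Q (g t))"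
  (is "?l \<longleftrightarrow> ?r")
proof
  assume ?r
  then show ?l by (elim disjE exE conjE) (force intro: rev_image_eqI)+
qed auto

text \<open>The mask is generalised in the induction because every level hands a smaller one to its
  halves. Distinctness of the letters lets the moves be counted without overlaps later.\<close>

lemma moves_correct:
  assumes "plan_ok n i" "wf_state n S"
  shows "x # w \<in> completions n S \<and> mem k x \<longleftrightarrow> (\<exists>t. (x, t) \<in> set (moves k S i) \<and> w \<in> completions n t)"
    and "distinct (map fst (moves k S i))"
    and "\<And>x t. (x, t) \<in> set (moves k S i) \<Longrightarrow> wf_state n t"
proof -
  have "(\<forall>x w. x # w \<in> completions n S \<and> mem k x \<longleftrightarrow> (\<exists>t. (x, t) \<in> set (moves k S i) \<and> w \<in> completions n t)) \<and>
      distinct (map fst (moves k S i)) \<and> (\<forall>(x, t)\<in>set (moves k S i). wf_state n t)"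
    using assms
  proof (induction i arbitrary: n S k)
    case Single
    then have "n = 1" "S = Fresh \<or> S = Done" by (cases S; simp)+
    from this(2) show ?case
    proof
      assume S: "S = Fresh"
      have W: "x # w \<in> completions n S \<longleftrightarrow> x = 0 \<and> w = []" for x w
        unfolding S completions.simps \<open>n = 1\<close> free_perms_1 by simp
      show ?case unfolding W by (cases "mem k 0") (auto simp: S \<open>n = 1\<close>)
    qed simp
  next
    case (Halves a b p q)
    define na nb where "na = (n + 1) div 2" and "nb = n div 2"
    have n: "n \<ge> 2" and oks: "plan_ok na a" "plan_ok nb b" "tree_ok na p" "tree_ok nb q"
      and leafs: "\<And>x y. x < na \<Longrightarrow> y < nb \<Longrightarrow> mem (leaf p x) y \<longleftrightarrow> \<not> near (n - 1) (2 * x) (2 * y + 1)"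
        "\<And>x y. x < na \<Longrightarrow> y < nb \<Longrightarrow> mem (leaf q y) x \<longleftrightarrow> \<not> near (n - 1) (2 * x) (2 * y + 1)"
      using Halves.prems(1) by (auto simp: na_def nb_def)
    have nz: "na \<ge> 1" "nb \<ge> 1" using n by (auto simp: na_def nb_def)
    have A: "u # w \<in> completions na S \<and> mem k u \<longleftrightarrow> (\<exists>t. (u, t) \<in> set (moves k S a) \<and> w \<in> completions na t)"
      "distinct (map fst (moves k S a))" "(u, t) \<in> set (moves k S a) \<Longrightarrow> wf_state na t"
      if "wf_state na S" for k S u t w
      using Halves.IH(1)[OF oks(1) that, of k] by auto
    have B: "u # w \<in> completions nb S \<and> mem k u \<longleftrightarrow> (\<exists>t. (u, t) \<in> set (moves k S b) \<and> w \<in> completions nb t)"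
      "distinct (map fst (moves k S b))" "(u, t) \<in> set (moves k S b) \<Longrightarrow> wf_state nb t"
      if "wf_state nb S" for k S u t w
      using Halves.IH(2)[OF oks(2) that, of k] by auto
    have dist: "distinct (map fst (map (\<lambda>(x, t). (2 * x, f t)) L @ map (\<lambda>(y, t). (2 * y + 1, g t)) M))"
      if "distinct (map fst L)" "distinct (map fst M)" for f g :: "state \<Rightarrow> state" and L M :: "(nat \<times> state) list"
    proof -
      have "map fst (map (\<lambda>(x, t). (2 * x, f t)) L) = map (\<lambda>x. 2 * x) (map fst L)"
        "map fst (map (\<lambda>(y, t). (2 * y + 1, g t)) M) = map (\<lambda>x. 2 * x + 1) (map fst M)"
        by (simp_all add: case_prod_unfold)
      moreover have "2 * x \<noteq> 2 * y + 1" for x y :: nat by presburger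
      ultimately show ?thesis
        using that by (auto simp: distinct_map inj_on_def simp del: map_map)
    qed
    note step = Cons_in_interleavings_moves[where n = n, folded na_def nb_def]
    have wf_eo: "wf_state n (eo u v)" "wf_state n (oe u v)" if "wf_state na u" "wf_state nb v" for u v
      using that n by (auto simp: eo_def oe_def na_def nb_def)
    show ?case
    proof (cases S)
      case Done
      then show ?thesis by simp
    next
      case Fresh
      \<comment> \<open>An even-first word on all letters cannot start with an odd letter, hence the
        mask \<open>No\<close> and the empty list for the odd half.\<close>
      have E: "x # w \<in> interleavings n 0 (completions na Fresh) (completions nb Fresh) \<and> mem k x \<longleftrightarrow>
          (\<exists>i t. x = 2 * i \<and> (i, t) \<in> set (moves (left k) Fresh a) \<and> w \<in> interleavings n 0 (completions na t) (completions nb Fresh)) \<or>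
          (\<exists>i t. x = 2 * i + 1 \<and> (i, t) \<in> set [] \<and> w \<in> interleavings n 0 (completions na Fresh) (completions nb t))" for x w
      proof (rule step[where kA = "left k" and kB = No])
        fix i assume "i < nb"
        then show "mem No i \<longleftrightarrow> mem k (2 * i + 1) \<and> (0 = 0 \<longrightarrow> (\<forall>y\<in>missing na Fresh. \<not> near (n - 1) (2 * y) (2 * i + 1)))"
          using near_exists(2)[OF n, of i] by (auto simp: na_def nb_def)
      qed ((rule A(1), use nz in simp) | simp add: mem_left)+
      have O: "x # w \<in> interleavings n 1 (completions na Fresh) (completions nb Fresh) \<and> mem k x \<longleftrightarrow>
          (\<exists>i t. x = 2 * i \<and> (i, t) \<in> set [] \<and> w \<in> interleavings n 1 (completions na t) (completions nb Fresh)) \<or>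
          (\<exists>i t. x = 2 * i + 1 \<and> (i, t) \<in> set (moves (right k) Fresh b) \<and> w \<in> interleavings n 1 (completions na Fresh) (completions nb t))" for x w
      proof (rule step[where kA = No and kB = "right k"])
        fix i assume "i < na"
        then show "mem No i \<longleftrightarrow> mem k (2 * i) \<and> (1 = 1 \<longrightarrow> (\<forall>y\<in>missing nb Fresh. \<not> near (n - 1) (2 * i) (2 * y + 1)))"
          using near_exists(1)[OF n, of i] by (auto simp: na_def nb_def)
      qed ((rule B(1), use nz in simp) | simp add: mem_right)+
      have VV: "completions n Fresh = interleavings n 0 (completions na Fresh) (completions nb Fresh) \<union> interleavings n 1 (completions na Fresh) (completions nb Fresh)"
        using free_perms_eq_interleavings[OF n] by (simp add: na_def nb_def)
      have eq: "x # w \<in> completions n Fresh \<and> mem k x \<longleftrightarrow>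
          (\<exists>i t. x = 2 * i \<and> (i, t) \<in> set (moves (left k) Fresh a) \<and> w \<in> interleavings n 0 (completions na t) (completions nb Fresh)) \<or>
          (\<exists>i t. x = 2 * i + 1 \<and> (i, t) \<in> set (moves (right k) Fresh b) \<and> w \<in> interleavings n 1 (completions na Fresh) (completions nb t))" for x w
        using E[of x w] O[of x w] unfolding VV by auto
      have "x # w \<in> completions n S \<and> mem k x \<longleftrightarrow> (\<exists>t. (x, t) \<in> set (moves k S (Halves a b p q)) \<and> w \<in> completions n t)" for x w
        unfolding Fresh eq moves.simps state.case ex_in_set_parity_maps by (simp add: na_def nb_def)
      moreover have "distinct (map fst (moves k S (Halves a b p q)))"
        unfolding Fresh moves.simps state.case by (rule dist) (use A(2) B(2) nz in auto)
      moreover have "\<forall>(x, t)\<in>set (moves k S (Halves a b p q)). wf_state n t"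
        using Fresh A(3)[of Fresh] B(3)[of Fresh] n nz by (auto simp: na_def nb_def)
      ultimately show ?thesis by blast
    next
      case (EO u v)
      have w: "wf_state na u" "wf_state nb v" using Halves.prems(2) EO by (auto simp: na_def nb_def)
      let ?kB = "meet (right k) (allowed u p)"
      have E: "x # w \<in> interleavings n 0 (completions na u) (completions nb v) \<and> mem k x \<longleftrightarrow>
          (\<exists>i t. x = 2 * i \<and> (i, t) \<in> set (moves (left k) u a) \<and> w \<in> interleavings n 0 (completions na t) (completions nb v)) \<or>
          (\<exists>i t. x = 2 * i + 1 \<and> (i, t) \<in> set (moves ?kB v b) \<and> w \<in> interleavings n 0 (completions na u) (completions nb t))" for x w
      proof (rule step[where kA = "left k" and kB = ?kB])
        fix i assume i: "i < nb"
        have "mem (allowed u p) i \<longleftrightarrow> (\<forall>y\<in>missing na u. \<not> near (n - 1) (2 * y) (2 * i + 1))"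
          unfolding mem_allowed[OF oks(3) w(1)] using leafs(1)[OF missing_less i] by blast
        then show "mem ?kB i \<longleftrightarrow> mem k (2 * i + 1) \<and> (0 = 0 \<longrightarrow> (\<forall>y\<in>missing na u. \<not> near (n - 1) (2 * y) (2 * i + 1)))"
          by (simp add: mem_right mem_meet)
      qed (rule A(1)[OF w(1)] B(1)[OF w(2)] | simp add: mem_left)+
      have "x # w \<in> completions n S \<and> mem k x \<longleftrightarrow> (\<exists>t. (x, t) \<in> set (moves k S (Halves a b p q)) \<and> w \<in> completions n t)" for x w
        unfolding EO moves.simps state.case ex_in_set_parity_maps completions.simps using E[of x w] by (simp only: completions_eo na_def nb_def)
      moreover have "distinct (map fst (moves k S (Halves a b p q)))"
        unfolding EO moves.simps state.case by (rule dist) (use A(2) B(2) w in auto)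
      moreover have "\<forall>(x, t)\<in>set (moves k S (Halves a b p q)). wf_state n t"
        using EO A(3)[OF w(1)] B(3)[OF w(2)] w wf_eo by auto
      ultimately show ?thesis by blast
    next
      case (OE u v)
      have w: "wf_state na u" "wf_state nb v" using Halves.prems(2) OE by (auto simp: na_def nb_def)
      let ?kA = "meet (left k) (allowed v q)"
      have E: "x # w \<in> interleavings n 1 (completions na u) (completions nb v) \<and> mem k x \<longleftrightarrow>
          (\<exists>i t. x = 2 * i \<and> (i, t) \<in> set (moves ?kA u a) \<and> w \<in> interleavings n 1 (completions na t) (completions nb v)) \<or>
          (\<exists>i t. x = 2 * i + 1 \<and> (i, t) \<in> set (moves (right k) v b) \<and> w \<in> interleavings n 1 (completions na u) (completions nb t))" for x w
      proof (rule step[where kA = ?kA and kB = "right k"])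
        fix i assume i: "i < na"
        have "mem (allowed v q) i \<longleftrightarrow> (\<forall>y\<in>missing nb v. \<not> near (n - 1) (2 * i) (2 * y + 1))"
          unfolding mem_allowed[OF oks(4) w(2)] using leafs(2)[OF i missing_less] by blast
        then show "mem ?kA i \<longleftrightarrow> mem k (2 * i) \<and> (1 = 1 \<longrightarrow> (\<forall>y\<in>missing nb v. \<not> near (n - 1) (2 * i) (2 * y + 1)))"
          by (simp add: mem_left mem_meet)
      qed (rule A(1)[OF w(1)] B(1)[OF w(2)] | simp add: mem_right)+
      have "x # w \<in> completions n S \<and> mem k x \<longleftrightarrow> (\<exists>t. (x, t) \<in> set (moves k S (Halves a b p q)) \<and> w \<in> completions n t)" for x w
        unfolding OE moves.simps state.case ex_in_set_parity_maps completions.simps using E[of x w] by (simp only: completions_oe na_def nb_def)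
      moreover have "distinct (map fst (moves k S (Halves a b p q)))"
        unfolding OE moves.simps state.case by (rule dist) (use A(2) B(2) w in auto)
      moreover have "\<forall>(x, t)\<in>set (moves k S (Halves a b p q)). wf_state n t"
        using OE A(3)[OF w(1)] B(3)[OF w(2)] w wf_eo by auto
      ultimately show ?thesis by blast
    qed
  qed
  then show "x # w \<in> completions n S \<and> mem k x \<longleftrightarrow> (\<exists>t. (x, t) \<in> set (moves k S i) \<and> w \<in> completions n t)"
    "distinct (map fst (moves k S i))"
    "\<And>x t. (x, t) \<in> set (moves k S i) \<Longrightarrow> wf_state n t"
    by auto
qed

definition next_states :: "mask \<Rightarrow> state \<Rightarrow> plan \<Rightarrow> state list" where
  "next_states k s i = map snd (moves k s i)"

lemma wf_next_states: "plan_ok n i \<Longrightarrow> wf_state n S \<Longrightarrow> t \<in> set (next_states k S i) \<Longrightarrow> wf_state n t"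
  using moves_correct(3) by (fastforce simp: next_states_def)

text \<open>The completions are partitioned by their first letter; each letter occurs in one move
  only, and the mask \<open>Yes\<close> excludes none.\<close>

lemma card_completions:
  assumes "plan_ok n i" "wf_state n S" "S \<noteq> Done"
  shows "card (completions n S) = (\<Sum>t\<leftarrow>next_states Yes S i. card (completions n t))"
proof -
  let ?L = "moves Yes S i"
  note m = moves_correct[OF assms(1,2), where k = Yes]
  have "[] \<notin> completions n S" using completions_set[of "[]" n S] missing_nonempty[OF assms(2,3)] by auto
  have "completions n S = (\<Union>(x, t)\<in>set ?L. (#) x ` completions n t)"
  proof (intro equalityI subsetI)
    fix w assume w: "w \<in> completions n S"
    then obtain x v where xv: "w = x # v" using \<open>[] \<notin> completions n S\<close> by (cases w) auto
    then obtain t where "(x, t) \<in> set ?L" "v \<in> completions n t" using m(1)[of x v] w by auto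
    then show "w \<in> (\<Union>(x, t)\<in>set ?L. (#) x ` completions n t)" using xv by blast
  next
    fix w assume "w \<in> (\<Union>(x, t)\<in>set ?L. (#) x ` completions n t)"
    then obtain x t v where "(x, t) \<in> set ?L" "v \<in> completions n t" "w = x # v" by blast
    then show "w \<in> completions n S" using m(1)[of x v] by auto
  qed
  also have "card \<dots> = (\<Sum>(x, t)\<in>set ?L. card ((#) x ` completions n t))"
  proof (subst card_UN_disjoint)
    have "t = t'" if "(x, t) \<in> set ?L" "(x, t') \<in> set ?L" for x t t'
      using that m(2) by (metis eq_key_imp_eq_value)
    then show "\<forall>y\<in>set ?L. \<forall>z\<in>set ?L. y \<noteq> z \<longrightarrow>
        (case y of (x, t) \<Rightarrow> (#) x ` completions n t) \<inter> (case z of (x, t) \<Rightarrow> (#) x ` completions n t) = {}"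
      by fastforce
  qed (auto simp: finite_completions split_beta)
  also have "\<dots> = (\<Sum>(x, t)\<in>set ?L. card (completions n t))"
    by (intro sum.cong refl) (auto simp: card_image)
  also have "\<dots> = (\<Sum>(x, t)\<leftarrow>?L. card (completions n t))"
    using m(2) by (subst sum_list_distinct_conv_sum_set) (auto simp: distinct_map)
  finally show ?thesis
    by (simp add: next_states_def comp_def case_prod_unfold)
qed

section \<open>Counting level by level\<close>

text \<open>Numbers in base 4, lowest digit first. They are used because the levels must be evaluated by rewriting: base 4 halves the size
  of the terms.\<close>

datatype quat = Q | Q0 quat | Q1 quat | Q2 quat | Q3 quat

fun val :: "quat \<Rightarrow> nat" where
  "val Q = 0"
| "val (Q0 x) = 4 * val x"
| "val (Q1 x) = 4 * val x + 1"
| "val (Q2 x) = 4 * val x + 2"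
| "val (Q3 x) = 4 * val x + 3"

fun inc :: "quat \<Rightarrow> quat" where
  "inc Q = Q1 Q"
| "inc (Q0 x) = Q1 x"
| "inc (Q1 x) = Q2 x"
| "inc (Q2 x) = Q3 x"
| "inc (Q3 x) = Q0 (inc x)"

fun add :: "quat \<Rightarrow> quat \<Rightarrow> quat" and addc :: "quat \<Rightarrow> quat \<Rightarrow> quat" where
  "add Q y = y"
| "add (Q0 x) Q = Q0 x" | "add (Q1 x) Q = Q1 x" | "add (Q2 x) Q = Q2 x" | "add (Q3 x) Q = Q3 x"
| "add (Q0 x) (Q0 y) = Q0 (add x y)" | "add (Q0 x) (Q1 y) = Q1 (add x y)"
| "add (Q0 x) (Q2 y) = Q2 (add x y)" | "add (Q0 x) (Q3 y) = Q3 (add x y)"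
| "add (Q1 x) (Q0 y) = Q1 (add x y)" | "add (Q1 x) (Q1 y) = Q2 (add x y)"
| "add (Q1 x) (Q2 y) = Q3 (add x y)" | "add (Q1 x) (Q3 y) = Q0 (addc x y)"
| "add (Q2 x) (Q0 y) = Q2 (add x y)" | "add (Q2 x) (Q1 y) = Q3 (add x y)"
| "add (Q2 x) (Q2 y) = Q0 (addc x y)" | "add (Q2 x) (Q3 y) = Q1 (addc x y)"
| "add (Q3 x) (Q0 y) = Q3 (add x y)" | "add (Q3 x) (Q1 y) = Q0 (addc x y)"
| "add (Q3 x) (Q2 y) = Q1 (addc x y)" | "add (Q3 x) (Q3 y) = Q2 (addc x y)"
| "addc Q y = inc y"
| "addc (Q0 x) Q = Q1 x" | "addc (Q1 x) Q = Q2 x" | "addc (Q2 x) Q = Q3 x" | "addc (Q3 x) Q = Q0 (inc x)"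
| "addc (Q0 x) (Q0 y) = Q1 (add x y)" | "addc (Q0 x) (Q1 y) = Q2 (add x y)"
| "addc (Q0 x) (Q2 y) = Q3 (add x y)" | "addc (Q0 x) (Q3 y) = Q0 (addc x y)"
| "addc (Q1 x) (Q0 y) = Q2 (add x y)" | "addc (Q1 x) (Q1 y) = Q3 (add x y)"
| "addc (Q1 x) (Q2 y) = Q0 (addc x y)" | "addc (Q1 x) (Q3 y) = Q1 (addc x y)"
| "addc (Q2 x) (Q0 y) = Q3 (add x y)" | "addc (Q2 x) (Q1 y) = Q0 (addc x y)"
| "addc (Q2 x) (Q2 y) = Q1 (addc x y)" | "addc (Q2 x) (Q3 y) = Q2 (addc x y)"
| "addc (Q3 x) (Q0 y) = Q0 (addc x y)" | "addc (Q3 x) (Q1 y) = Q1 (addc x y)"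
| "addc (Q3 x) (Q2 y) = Q2 (addc x y)" | "addc (Q3 x) (Q3 y) = Q3 (addc x y)"

lemma val_inc: "val (inc x) = val x + 1"
  by (induction x) auto

lemma val_add: "val (add x y) = val x + val y" and val_addc: "val (addc x y) = val x + val y + 1"
  by (induction x y and x y rule: add_addc.induct) (simp_all add: val_inc)

section \<open>Weighted tries of states\<close>

text \<open>A trie of weighted states, branching over the constructors of the state in prefix order; a tip keeps the unread rest of
  its path. Merging compares whole states and \<open>Join\<close> absorbs every mismatch, so that no invariant is needed.\<close>

datatype trie = Empty | Tip "state list" state quat | Fork trie trie trie trie | Join trie trie

fun weight :: "(state \<Rightarrow> nat) \<Rightarrow> trie \<Rightarrow> nat" where
  "weight g Empty = 0"
| "weight g (Tip k s c) = val c * g s"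
| "weight g (Fork a b c d) = weight g a + weight g b + weight g c + weight g d"
| "weight g (Join a b) = weight g a + weight g b"

fun states :: "trie \<Rightarrow> state set" where
  "states Empty = {}"
| "states (Tip k s c) = {s}"
| "states (Fork a b c d) = states a \<union> states b \<union> states c \<union> states d"
| "states (Join a b) = states a \<union> states b"

text \<open>Pushes a tip one constructor further down, so that an insertion that meets a different
  state there can be retried.\<close>

fun expand :: "state list \<Rightarrow> state \<Rightarrow> quat \<Rightarrow> trie" where
  "expand [] s c = Join Empty (Tip [] s c)"
| "expand (Fresh # k) s c = Fork (Tip k s c) Empty Empty Empty"
| "expand (Done # k) s c = Fork Empty (Tip k s c) Empty Empty"
| "expand (EO a b # k) s c = Fork Empty Empty (Tip (a # b # k) s c) Empty"
| "expand (OE a b # k) s c = Fork Empty Empty Empty (Tip (a # b # k) s c)"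

lemma expand_simps [simp]: "weight g (expand k s c) = val c * g s" "states (expand k s c) = {s}"
  by (cases "(k, s, c)" rule: expand.cases; simp)+

fun rank :: "trie \<Rightarrow> nat" where
  "rank (Tip k s c) = 3"
| "rank (Join a b) = Suc (rank a)"
| "rank t = 0"

lemma rank_expand: "rank (expand k s c) < 3"
  by (cases "(k, s, c)" rule: expand.cases) auto

function (sequential) put :: "quat \<Rightarrow> state \<Rightarrow> state list \<Rightarrow> trie \<Rightarrow> trie" where
  "put c s k Empty = Tip k s c"
| "put c s k (Tip l u e) = (if u = s then Tip l s (add e c) else put c s k (expand l u e))"
| "put c s k (Join x y) = Join (put c s k x) y"
| "put c s (Fresh # k) (Fork x y z w) = Fork (put c s k x) y z w"
| "put c s (Done # k) (Fork x y z w) = Fork x (put c s k y) z w"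
| "put c s (EO a b # k) (Fork x y z w) = Fork x y (put c s (a # b # k) z) w"
| "put c s (OE a b # k) (Fork x y z w) = Fork x y z (put c s (a # b # k) w)"
| "put c s [] (Fork x y z w) = Join (Fork x y z w) (Tip [] s c)"
  by pat_completeness auto
termination put
  \<comment> \<open>Replacing \<open>EO a b\<close> by a and b on the path lowers the first measure,
    thanks to the factor 2 and the summand 1. Expanding a tip leaves the path alone and lowers the
    rank, which is 3 for tips only to exceed that of every expansion.\<close>
  by (relation "measures [\<lambda>(c, s, k, t). \<Sum>s\<leftarrow>k. 2 * size s + 1, \<lambda>(c, s, k, t). rank t]")
    (auto simp: rank_expand)

lemma put_weight: "weight g (put c s k t) = weight g t + val c * g s"
  by (induction c s k t rule: put.induct) (auto simp: val_add algebra_simps)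

lemma put_states: "states (put c s k t) = insert s (states t)"
  by (induction c s k t rule: put.induct) auto

function (sequential) unite :: "trie \<Rightarrow> trie \<Rightarrow> trie" where
  "unite Empty t = t"
| "unite (Tip k s c) t = put c s k t"
| "unite (Join x y) t = Join (unite x t) y"
| "unite (Fork x y z w) Empty = Fork x y z w"
| "unite (Fork x y z w) (Tip k s c) = put c s k (Fork x y z w)"
| "unite (Fork x y z w) (Join t u) = Join (unite (Fork x y z w) t) u"
| "unite (Fork x y z w) (Fork x' y' z' w') = Fork (unite x x') (unite y y') (unite z z') (unite w w')"
  by pat_completeness auto
termination unite
  by (relation "measure (\<lambda>(x, y). size x + size y)") auto

lemma unite_weight: "weight g (unite t u) = weight g t + weight g u"
  by (induction t u rule: unite.induct) (auto simp: put_weight)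

lemma unite_states: "states (unite t u) = states t \<union> states u"
  by (induction t u rule: unite.induct) (auto simp: put_states)

fun join :: "trie \<Rightarrow> trie \<Rightarrow> trie" where
  "join Empty t = t"
| "join (Tip k s c) Empty = Tip k s c"
| "join (Join x y) Empty = Join x y"
| "join (Fork x y z w) Empty = Fork x y z w"
| "join t (Tip k s c) = Join t (Tip k s c)"
| "join t (Join x y) = Join t (Join x y)"
| "join t (Fork x y z w) = Join t (Fork x y z w)"

lemma join_simps [simp]: "weight g (join t u) = weight g t + weight g u" "states (join t u) = states t \<union> states u"
  by (cases "(t, u)" rule: join.cases; simp)+

text \<open>The branching serves only to merge equal states within a level. Before the next level
  the forks are dissolved and their empty branches dropped.\<close>

fun flatten :: "trie \<Rightarrow> trie" where
  "flatten Empty = Empty"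
| "flatten (Tip k s c) = Tip k s c"
| "flatten (Join x y) = Join x y"
| "flatten (Fork x y z w) = join (join (flatten x) (flatten y)) (join (flatten z) (flatten w))"

lemma flatten_simps [simp]: "weight g (flatten t) = weight g t" "states (flatten t) = states t"
  by (induction t) auto

fun spread :: "quat \<Rightarrow> state list \<Rightarrow> trie" where
  "spread c [] = Empty"
| "spread c (s # r) = put c s [s] (spread c r)"

lemma spread_simps [simp]: "weight g (spread c l) = val c * (\<Sum>s\<leftarrow>l. g s)" "states (spread c l) = set l"
  by (induction l) (auto simp: put_weight put_states algebra_simps)

text \<open>The empty word is the one completion of \<open>Done\<close>; with a loop there, a step
  preserves the weighted count at every well-formed state.\<close>

definition successors :: "state \<Rightarrow> plan \<Rightarrow> state list" where
  "successors s i = (if s = Done then [Done] else next_states Yes s i)"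

fun step :: "trie \<Rightarrow> plan \<Rightarrow> trie" where
  "step Empty i = Empty"
| "step (Tip k s c) i = spread c (successors s i)"
| "step (Join x y) i = unite (step x i) (step y i)"
| "step (Fork x y z w) i = unite (unite (step x i) (step y i)) (unite (step z i) (step w i))"

text \<open>The invariant of the count: each state passes its coefficient to all its successors,
  whose completions together are as many as its own.\<close>

lemma weight_step:
  assumes "plan_ok n i"
  shows "states t \<subseteq> {s. wf_state n s} \<Longrightarrow> weight (\<lambda>s. card (completions n s)) (step t i) = weight (\<lambda>s. card (completions n s)) t"
proof (induction t)
  case (Tip k s c)
  then have "(\<Sum>t\<leftarrow>successors s i. card (completions n t)) = card (completions n s)"
    using card_completions[OF assms, of s] by (simp add: successors_def)
  then show ?case by simp
qed (simp_all add: unite_weight)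

lemma wf_step:
  assumes "plan_ok n i"
  shows "states t \<subseteq> {s. wf_state n s} \<Longrightarrow> states (step t i) \<subseteq> {s. wf_state n s}"
proof (induction t)
  case (Tip k s c)
  have "wf_state n t" if "t \<in> set (successors s i)" for t
    using that wf_next_states[OF assms, of s t Yes] Tip by (simp add: successors_def split: if_splits)
  then show ?case by auto
qed (simp_all add: unite_states)

text \<open>The first argument only supplies the number of steps.\<close>

fun run :: "nat list \<Rightarrow> trie \<Rightarrow> plan \<Rightarrow> trie" where
  "run [] t i = t"
| "run (x # l) t i = run l (step (flatten t) i) i"

lemma weight_run:
  assumes "plan_ok n i"
  shows "states t \<subseteq> {s. wf_state n s} \<Longrightarrow> weight (\<lambda>s. card (completions n s)) (run l t i) = weight (\<lambda>s. card (completions n s)) t"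
proof (induction l arbitrary: t)
  case (Cons x l)
  have f: "states (flatten t) \<subseteq> {s. wf_state n s}" using Cons.prems by simp
  show ?case
    unfolding run.simps using Cons.IH[OF wf_step[OF assms f]] weight_step[OF assms f] by simp
qed simp

section \<open>Building the plan\<close>

fun evens :: "'a list \<Rightarrow> 'a list" and odds :: "'a list \<Rightarrow> 'a list" where
  "evens [] = []"
| "evens (x # l) = x # odds l"
| "odds [] = []"
| "odds (x # l) = evens l"

lemma length_evens [simp]: "length (evens l) = (length l + 1) div 2"
  and length_odds [simp]: "length (odds l) = length l div 2"
  by (induction l) auto

lemma nth_evens: "2 * i < length l \<Longrightarrow> evens l ! i = l ! (2 * i)"
  and nth_odds: "2 * i + 1 < length l \<Longrightarrow> odds l ! i = l ! (2 * i + 1)"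
proof (induction l arbitrary: i)
  case (Cons x l)
  {
    case 1
    then show ?case using Cons(2)[of "i - 1"] by (cases i) auto
  next
    case 2
    then show ?case using Cons(1)[of i] by auto
  }
qed auto

fun mask_of :: "bool list \<Rightarrow> mask" where
  "mask_of [] = No"
| "mask_of [True] = Yes"
| "mask_of [False] = No"
| "mask_of (x # y # l) = split (mask_of (evens (x # y # l))) (mask_of (odds (x # y # l)))"

lemma nth_parity:
  assumes "x < length l"
  shows "x div 2 < length (if even x then evens l else odds l) \<and>
    (if even x then evens l else odds l) ! (x div 2) = l ! x"
proof (cases "even x")
  case True
  then obtain i where x: "x = 2 * i" by blast
  show ?thesis using assms half_less(1)[of i "length l"] nth_evens[of i l] by (simp add: x)
next
  case False
  then obtain i where x: "x = 2 * i + 1" by (rule oddE)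
  show ?thesis using assms half_less(2)[of i "length l"] nth_odds[of i l] by (simp add: x)
qed

lemma mem_mask_of: "x < length l \<Longrightarrow> mem (mask_of l) x \<longleftrightarrow> l ! x"
proof (induction l arbitrary: x rule: mask_of.induct)
  case (4 a b l)
  show ?case
  proof (cases "even x")
    case True
    then show ?thesis using 4(1)[of "x div 2"] nth_parity[OF 4(3)] by (simp add: mem_split del: evens.simps odds.simps)
  next
    case False
    then show ?thesis using 4(2)[of "x div 2"] nth_parity[OF 4(3)] by (simp add: mem_split del: evens.simps odds.simps)
  qed
qed auto

fun node :: "mtree \<Rightarrow> mtree \<Rightarrow> mtree" where
  "node l r = Node (meet (cached l) (cached r)) l r"

fun tree_of :: "mask list \<Rightarrow> mtree" where
  "tree_of [] = Leaf No"
| "tree_of [k] = Leaf k"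
| "tree_of (x # y # l) = node (tree_of (evens (x # y # l))) (tree_of (odds (x # y # l)))"

lemma tree_of_ok: "l \<noteq> [] \<Longrightarrow> tree_ok (length l) (tree_of l)"
proof (induction l rule: tree_of.induct)
  case (3 x y l)
  have "evens (x # y # l) \<noteq> []" "odds (x # y # l) \<noteq> []" by auto
  from 3(1)[OF this(1)] 3(2)[OF this(2)] show ?case by (simp del: evens.simps odds.simps)
qed auto

lemma leaf_tree_of: "x < length l \<Longrightarrow> leaf (tree_of l) x = l ! x"
proof (induction l arbitrary: x rule: tree_of.induct)
  case (3 a b l)
  show ?case
  proof (cases "even x")
    case True
    then show ?thesis using 3(1)[of "x div 2"] nth_parity[OF 3(3)] by (simp del: evens.simps odds.simps)
  next
    case False
    then show ?thesis using 3(2)[of "x div 2"] nth_parity[OF 3(3)] by (simp del: evens.simps odds.simps)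
  qed
qed auto

fun row :: "nat \<Rightarrow> nat \<Rightarrow> nat list \<Rightarrow> bool list" where
  "row m y [] = []"
| "row m y (x # l) = (\<not> near m x y) # row m y l"

fun rows :: "nat \<Rightarrow> nat list \<Rightarrow> nat list \<Rightarrow> mask list" where
  "rows m xs [] = []"
| "rows m xs (y # l) = mask_of (row m y xs) # rows m xs l"

lemma row_eq: "row m y l = map (\<lambda>x. \<not> near m x y) l"
  by (induction l) auto

lemma rows_eq: "rows m xs l = map (\<lambda>y. mask_of (row m y xs)) l"
  by (induction l) auto

text \<open>The first list acts as a unary length, so that the shorter intervals are obtained
  without dividing n.\<close>

fun prefix_like :: "'a list \<Rightarrow> 'b list \<Rightarrow> 'b list" where
  "prefix_like [] l = []"
| "prefix_like (x # r) [] = []"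
| "prefix_like (x # r) (y # l) = y # prefix_like r l"

lemma prefix_like_eq: "prefix_like r l = take (length r) l"
  by (induction r l rule: prefix_like.induct) auto

text \<open>Intended for \<open>[0..<n]\<close>: the shape of the list drives the recursion, and its
  last entry is the bound n - 1 for \<open>near\<close>.\<close>

function plan_of :: "nat list \<Rightarrow> plan" where
  "plan_of [] = Single"
| "plan_of [x] = Single"
| "plan_of (x # y # l) = Halves
     (plan_of (prefix_like (evens (x # y # l)) (x # y # l))) (plan_of (prefix_like (odds (x # y # l)) (x # y # l)))
     (tree_of (rows (last (y # l)) (odds (x # y # l)) (evens (x # y # l))))
     (tree_of (rows (last (y # l)) (evens (x # y # l)) (odds (x # y # l))))"
  by pat_completeness auto
termination
  by (relation "measure length") (auto simp: prefix_like_eq)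

lemma evens_upt: "evens [0..<n] = map (\<lambda>i. 2 * i) [0..<(n + 1) div 2]"
  by (rule nth_equalityI) (auto simp: nth_evens half_less[symmetric])

lemma odds_upt: "odds [0..<n] = map (\<lambda>i. 2 * i + 1) [0..<n div 2]"
  by (rule nth_equalityI) (use half_less(2)[of _ n] in \<open>auto simp: nth_odds\<close>)

lemma leaf_rows:
  assumes "i < length l" "j < length xs"
  shows "mem (leaf (tree_of (rows m xs l)) i) j \<longleftrightarrow> \<not> near m (xs ! j) (l ! i)"
  using assms by (simp add: leaf_tree_of rows_eq mem_mask_of row_eq)

lemma plan_of_Halves:
  assumes "n \<ge> 2"
  shows "plan_of [0..<n] = Halves (plan_of [0..<(n + 1) div 2]) (plan_of [0..<n div 2])
    (tree_of (rows (n - 1) (odds [0..<n]) (evens [0..<n]))) (tree_of (rows (n - 1) (evens [0..<n]) (odds [0..<n])))"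
proof -
  obtain x y l where xyl: "[0..<n] = x # y # l"
    using assms by (metis Suc_le_length_iff length_upt minus_nat.diff_0 numeral_2_eq_2)
  have "last (y # l) = last [0..<n]" unfolding xyl by simp
  then have "last (y # l) = n - 1" using assms by simp
  moreover have "prefix_like (evens [0..<n]) [0..<n] = [0..<(n + 1) div 2]" "prefix_like (odds [0..<n]) [0..<n] = [0..<n div 2]"
    using assms by (auto simp: prefix_like_eq take_upt)
  ultimately show ?thesis using plan_of.simps(3)[of x y l] unfolding xyl[symmetric] by metis
qed

lemma plan_of_ok: "n \<ge> 1 \<Longrightarrow> plan_ok n (plan_of [0..<n])"
proof (induction n rule: less_induct)
  case (less n)
  show ?case
  proof (cases "n = 1")
    case False
    then have n: "n \<ge> 2" using less.prems by simp
    have "tree_ok (length (rows m xs l)) (tree_of (rows m xs l))" if "l \<noteq> []" for m xs l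
      by (rule tree_of_ok) (use that in \<open>simp add: rows_eq\<close>)
    from this[of "evens [0..<n]"] this[of "odds [0..<n]"]
    have "tree_ok ((n + 1) div 2) (tree_of (rows (n - 1) (odds [0..<n]) (evens [0..<n])))"
      "tree_ok (n div 2) (tree_of (rows (n - 1) (evens [0..<n]) (odds [0..<n])))"
      using n by (auto simp: rows_eq evens_upt odds_upt)
    moreover have "mem (leaf (tree_of (rows (n - 1) (odds [0..<n]) (evens [0..<n]))) x) y \<longleftrightarrow> \<not> near (n - 1) (2 * x) (2 * y + 1)"
      "mem (leaf (tree_of (rows (n - 1) (evens [0..<n]) (odds [0..<n]))) y) x \<longleftrightarrow> \<not> near (n - 1) (2 * x) (2 * y + 1)"
      if "x < (n + 1) div 2" "y < n div 2" for x y
      using that near_commute[of "n - 1" "2 * x"] by (simp_all add: leaf_rows evens_upt odds_upt)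
    ultimately show ?thesis
      using less.IH[of "(n + 1) div 2"] less.IH[of "n div 2"] n
      unfolding plan_of_Halves[OF n] by simp
  qed simp
qed

text \<open>Starting at \<open>EO Fresh Fresh\<close> instead of \<open>Fresh\<close> uses the
  reversal symmetry and leaves only half of the words to be counted.\<close>

theorem theta_eq_run:
  assumes "n \<ge> 2"
  shows "theta n = 2 * weight (\<lambda>s. card (completions n s)) (run [0..<n] (Tip [] (EO Fresh Fresh) (Q1 Q)) (plan_of [0..<n]))"
proof -
  have "weight (\<lambda>s. card (completions n s)) (run [0..<n] (Tip [] (EO Fresh Fresh) (Q1 Q)) (plan_of [0..<n])) =
      weight (\<lambda>s. card (completions n s)) (Tip [] (EO Fresh Fresh) (Q1 Q))"
    by (rule weight_run[OF plan_of_ok]) (use assms in auto)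
  then show ?thesis
    using card_free_perms[OF assms] by (simp add: theta_eq_card_free_perms)
qed

section \<open>Evaluation\<close>

text \<open>The simplifier rewrites arguments first. The rules below are first order and free of conditionals: a branch is selected by an
  auxiliary function of an already evaluated argument. Large arguments come last, since every partial application is traversed.\<close>

fun eo_left :: "state list \<Rightarrow> state \<Rightarrow> state list \<Rightarrow> state list" where
  "eo_left [] b r = r"
| "eo_left (a # l) b r = eo a b # eo_left l b r"

fun eo_right :: "state list \<Rightarrow> state \<Rightarrow> state list \<Rightarrow> state list" where
  "eo_right [] a r = r"
| "eo_right (b # l) a r = eo a b # eo_right l a r"

fun oe_left :: "state list \<Rightarrow> state \<Rightarrow> state list \<Rightarrow> state list" where
  "oe_left [] b r = r"
| "oe_left (a # l) b r = oe a b # oe_left l b r"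

fun oe_right :: "state list \<Rightarrow> state \<Rightarrow> state list \<Rightarrow> state list" where
  "oe_right [] a r = r"
| "oe_right (b # l) a r = oe a b # oe_right l a r"

lemma eo_oe_maps:
  "eo_left l b r = map (\<lambda>a. eo a b) l @ r" "eo_right l b r = map (eo b) l @ r"
  "oe_left l b r = map (\<lambda>a. oe a b) l @ r" "oe_right l b r = map (oe b) l @ r"
  by (induction l) auto

lemma eo_rules:
  "eo Fresh b = EO Fresh b" "eo (EO x y) b = EO (EO x y) b" "eo (OE x y) b = EO (OE x y) b"
  "eo Done Done = Done" "eo Done Fresh = EO Done Fresh" "eo Done (EO x y) = EO Done (EO x y)" "eo Done (OE x y) = EO Done (OE x y)"
  "oe Fresh b = OE Fresh b" "oe (EO x y) b = OE (EO x y) b" "oe (OE x y) b = OE (OE x y) b"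
  "oe Done Done = Done" "oe Done Fresh = OE Done Fresh" "oe Done (EO x y) = OE Done (EO x y)" "oe Done (OE x y) = OE Done (OE x y)"
  by (simp_all add: eo_def oe_def)

text \<open>With \<open>meet\<close> both masks would be evaluated in advance; here the second
  subtree is entered only once the first mask is known to differ from \<open>No\<close>.\<close>

definition meet_allowed :: "mask \<Rightarrow> state \<Rightarrow> mtree \<Rightarrow> mask" where
  "meet_allowed k b r = meet k (allowed b r)"

lemma allowed_rules:
  "allowed Done p = Yes"
  "allowed Fresh (Leaf k) = k"
  "allowed Fresh (Node k l r) = k"
  "allowed (EO a b) (Node k l r) = meet_allowed (allowed a l) b r"
  "allowed (OE a b) (Node k l r) = meet_allowed (allowed a l) b r"
  "meet_allowed No b r = No"
  "meet_allowed Yes b r = allowed b r"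
  "meet_allowed (Split x y) b r = meet (Split x y) (allowed b r)"
  by (simp_all add: meet_allowed_def)

lemma moves_No: "moves No s i = []"
  by (induction i arbitrary: s) (auto split: state.split)

lemma moves_Done: "moves k Done i = []"
  by (cases i) auto

lemma next_states_Halves:
  "next_states k Fresh (Halves a b p q) =
    eo_left (next_states (left k) Fresh a) Fresh (oe_right (next_states (right k) Fresh b) Fresh [])"
  "next_states k (EO s t) (Halves a b p q) =
    eo_left (next_states (left k) s a) t (eo_right (next_states (meet (right k) (allowed s p)) t b) s [])"
  "next_states k (OE s t) (Halves a b p q) =
    oe_left (next_states (meet (left k) (allowed t q)) s a) t (oe_right (next_states (right k) t b) s [])"
  by (simp_all add: next_states_def eo_oe_maps comp_def case_prod_unfold eo_def oe_def)

lemma next_states_rules: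
  "next_states No s i = []"
  "next_states Yes Done i = []"
  "next_states (Split x y) Done i = []"
  "next_states Yes Fresh Single = [Done]"
  "next_states Yes Fresh (Halves a b p q) =
    eo_left (next_states Yes Fresh a) Fresh (oe_right (next_states Yes Fresh b) Fresh [])"
  "next_states (Split x y) Fresh (Halves a b p q) =
    eo_left (next_states x Fresh a) Fresh (oe_right (next_states y Fresh b) Fresh [])"
  "next_states Yes (EO s t) (Halves a b p q) =
    eo_left (next_states Yes s a) t (eo_right (next_states (allowed s p) t b) s [])"
  "next_states (Split x y) (EO s t) (Halves a b p q) =
    eo_left (next_states x s a) t (eo_right (next_states (meet y (allowed s p)) t b) s [])"
  "next_states Yes (OE s t) (Halves a b p q) =
    oe_left (next_states (allowed t q) s a) t (oe_right (next_states Yes t b) s [])"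
  "next_states (Split x y) (OE s t) (Halves a b p q) =
    oe_left (next_states (meet x (allowed t q)) s a) t (oe_right (next_states y t b) s [])"
  by (simp_all only: next_states_Halves left.simps right.simps meet.simps)
    (simp_all add: next_states_def moves_No moves_Done)

lemma successors_rules:
  "successors Done i = [Done]"
  "successors Fresh i = next_states Yes Fresh i"
  "successors (EO s t) i = next_states Yes (EO s t) i"
  "successors (OE s t) i = next_states Yes (OE s t) i"
  by (simp_all add: successors_def)

text \<open>A conjunction that stops early: the second components are compared only after the first
  ones have turned out equal.\<close>

definition both_eq :: "bool \<Rightarrow> state \<Rightarrow> state \<Rightarrow> bool" where
  "both_eq c x y \<longleftrightarrow> c \<and> x = y"

lemma state_eq_rules:
  "(Fresh = Fresh) = True" "(Fresh = Done) = False" "(Fresh = EO a b) = False" "(Fresh = OE a b) = False"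
  "(Done = Fresh) = False" "(Done = Done) = True" "(Done = EO a b) = False" "(Done = OE a b) = False"
  "(EO a b = Fresh) = False" "(EO a b = Done) = False" "(EO a b = EO c d) = both_eq (a = c) b d" "(EO a b = OE c d) = False"
  "(OE a b = Fresh) = False" "(OE a b = Done) = False" "(OE a b = EO c d) = False" "(OE a b = OE c d) = both_eq (a = c) b d"
  "both_eq False b d = False" "both_eq True b d = (b = d)"
  by (auto simp: both_eq_def)

definition merge :: "bool \<Rightarrow> quat \<Rightarrow> state \<Rightarrow> state list \<Rightarrow> quat \<Rightarrow> state \<Rightarrow> state list \<Rightarrow> trie" where
  "merge b e u l c s k = (if b then Tip l s (add e c) else put c s k (expand l u e))"

lemma put_rules:
  "put c s k Empty = Tip k s c"
  "put c s k (Tip l u e) = merge (u = s) e u l c s k"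
  "put c s k (Join x y) = Join (put c s k x) y"
  "put c s (Fresh # k) (Fork x y z w) = Fork (put c s k x) y z w"
  "put c s (Done # k) (Fork x y z w) = Fork x (put c s k y) z w"
  "put c s (EO a b # k) (Fork x y z w) = Fork x y (put c s (a # b # k) z) w"
  "put c s (OE a b # k) (Fork x y z w) = Fork x y z (put c s (a # b # k) w)"
  "merge True e u l c s k = Tip l s (add e c)"
  "merge False e u l c s k = put c s k (expand l u e)"
  by (simp_all add: merge_def)

text \<open>An opaque name for the cardinality: the evaluation needs only its value 1 at
  \<open>Done\<close>.\<close>

definition count_completions :: "nat \<Rightarrow> state \<Rightarrow> nat" where
  "count_completions n s = card (completions n s)"

lemma count_completions_Done: "count_completions n Done = 1"
  by (simp add: count_completions_def)

lemma theta_eqI: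
  assumes "2 \<le> n"
    and "2 * weight (count_completions n) (run [0..<n] (Tip [] (EO Fresh Fresh) (Q1 Q)) (plan_of [0..<n])) = m"
  shows "theta n = m"
proof -
  have "count_completions n = (\<lambda>s. card (completions n s))" by (rule ext) (rule count_completions_def)
  then show ?thesis using theta_eq_run[OF assms(1)] assms(2) by simp
qed

lemma upt_rules:
  "[0..<numeral k] = 0 # [1..<numeral k]"
  "1 < (numeral k :: nat) \<Longrightarrow> [1..<numeral k] = 1 # [2..<numeral k]"
  "(numeral j :: nat) < numeral k \<Longrightarrow> [numeral j..<numeral k] = numeral j # [numeral (j + Num.One)..<numeral k]"
  "[numeral k..<numeral k] = []"
  using upt_conv_Cons[of 0 "numeral k"] upt_conv_Cons[of 1 "numeral k"] upt_conv_Cons[of "numeral j" "numeral k"]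
  by (simp_all only: Suc_numeral Suc_1 zero_less_numeral upt_conv_Nil order_refl One_nat_def[symmetric])

lemmas numeral_rules = arith_simps rel_simps numeral_plus_one one_plus_numeral one_add_one simp_thms

lemmas plan_rules = upt_rules last.simps list.distinct if_True if_False evens.simps odds.simps prefix_like.simps
  mask_of.simps row.simps rows.simps near_def node.simps cached.simps tree_of.simps plan_of.simps

lemmas run_rules = split.simps meet.simps allowed_rules eo_rules eo_left.simps eo_right.simps oe_left.simps oe_right.simps
  next_states_rules successors_rules inc.simps add.simps addc.simps state_eq_rules expand.simps put_rules unite.simps
  join.simps flatten.simps spread.simps step.simps run.simps

lemmas eval_rules = numeral_rules plan_rules run_rules weight.simps count_completions_Done

text \<open>The list of values follows the induction: 23..36 as its base, 44 and 45 because they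
  have the half 22, 74..86 because their halves lie in 37..43, and 37 and 43 as factors at 73 and
  87.\<close>

lemma theta_23: "theta 23 = 38431556"
  by (rule theta_eqI, simp, simp only: eval_rules, simp)

lemma theta_24: "theta 24 = 96547832"
  by (rule theta_eqI, simp, simp only: eval_rules, simp)

lemma theta_25: "theta 25 = 198410168"
  by (rule theta_eqI, simp, simp only: eval_rules, simp)

lemma theta_26: "theta 26 = 419141312"
  by (rule theta_eqI, simp, simp only: eval_rules, simp)

lemma theta_27: "theta 27 = 941812088"
  by (rule theta_eqI, simp, simp only: eval_rules, simp)

lemma theta_28: "theta 28 = 2181990978"
  by (rule theta_eqI, simp, simp only: eval_rules, simp)

lemma theta_29: "theta 29 = 5624657008"
  by (rule theta_eqI, simp, simp only: eval_rules, simp)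

lemma theta_30: "theta 30 = 14765405996"
  by (rule theta_eqI, simp, simp only: eval_rules, simp)

lemma theta_31: "theta 31 = 41918682488"
  by (rule theta_eqI, simp, simp only: eval_rules, simp)

lemma theta_32: "theta 32 = 121728075232"
  by (rule theta_eqI, simp, simp only: eval_rules, simp)

lemma theta_33: "theta 33 = 207996053184"
  by (rule theta_eqI, simp, simp only: eval_rules, simp)

lemma theta_34: "theta 34 = 360257593216"
  by (rule theta_eqI, simp, simp only: eval_rules, simp)

lemma theta_35: "theta 35 = 639536491376"
  by (rule theta_eqI, simp, simp only: eval_rules, simp)

lemma theta_36: "theta 36 = 1144978334240"
  by (rule theta_eqI, simp, simp only: eval_rules, simp)

lemma theta_37: "theta 37 = 2362611440576"
  by (rule theta_eqI, simp, simp only: eval_rules, simp)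

lemma theta_43: "theta 43 = 265157938869936"
  by (rule theta_eqI, simp, simp only: eval_rules, simp)

lemma theta_44: "theta 44 = 622473467900178"
  by (rule theta_eqI, simp, simp only: eval_rules, simp)

lemma theta_45: "theta 45 = 1527398824248200"
  by (rule theta_eqI, simp, simp only: eval_rules, simp)

lemma theta_74: "theta 74 = 14611112240136930804928288"
  by (rule theta_eqI, simp, simp only: eval_rules, simp)

lemma theta_75: "theta 75 = 30235147387260979648843264"
  by (rule theta_eqI, simp, simp only: eval_rules, simp)

lemma theta_76: "theta 76 = 62757445134327428602306464"
  by (rule theta_eqI, simp, simp only: eval_rules, simp)

lemma theta_77: "theta 77 = 132956581436718531491070160"
  by (rule theta_eqI, simp, simp only: eval_rules, simp)

lemma theta_78: "theta 78 = 282272593229156186280461264"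
  by (rule theta_eqI, simp, simp only: eval_rules, simp)

lemma theta_79: "theta 79 = 605672649054377049472147568"
  by (rule theta_eqI, simp, simp only: eval_rules, simp)

lemma theta_80: "theta 80 = 1302375489530691442230524528"
  by (rule theta_eqI, simp, simp only: eval_rules, simp)

lemma theta_81: "theta 81 = 2914298247043287576460093712"
  by (rule theta_eqI, simp, simp only: eval_rules, simp)

lemma theta_82: "theta 82 = 6537258415569149903366841040"
  by (rule theta_eqI, simp, simp only: eval_rules, simp)

lemma theta_83: "theta 83 = 14713284774210886488265138336"
  by (rule theta_eqI, simp, simp only: eval_rules, simp)

lemma theta_84: "theta 84 = 33155372641605493828236640928"
  by (rule theta_eqI, simp, simp only: eval_rules, simp)

lemma theta_85: "theta 85 = 77219028670778815210019118736"
  by (rule theta_eqI, simp, simp only: eval_rules, simp)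

lemma theta_86: "theta 86 = 180104653062631494787580542664"
  by (rule theta_eqI, simp, simp only: eval_rules, simp)

lemmas theta_values =
  theta_23 theta_24 theta_25 theta_26 theta_27 theta_28 theta_29 theta_30
  theta_31 theta_32 theta_33 theta_34 theta_35 theta_36 theta_37 theta_43
  theta_44 theta_45 theta_74 theta_75 theta_76 theta_77 theta_78 theta_79
  theta_80 theta_81 theta_82 theta_83 theta_84 theta_85 theta_86

section \<open>Growth\<close>

text \<open>All even letters followed by all odd letters satisfy every order constraint, whatever
  the two 3-free halves are. Reversal doubles the number.\<close>

lemma theta_halves:
  assumes "n \<ge> 2"
  shows "2 * theta ((n + 1) div 2) * theta (n div 2) \<le> theta n"
proof -
  let ?X = "free_perms ((n + 1) div 2)" and ?Y = "free_perms (n div 2)"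
  let ?f = "\<lambda>(u, v). map (\<lambda>x. 2 * x :: nat) u @ map (\<lambda>x. 2 * x + 1) v"
  have half: "half 0 (?f (u, v)) = u" "half 1 (?f (u, v)) = v" for u v
    by (simp_all add: half_def comp_def filter_map)
  have "?f (u, v) \<in> interleavings n 0 ?X ?Y" if "u \<in> ?X" "v \<in> ?Y" for u v
  proof -
    have u: "distinct u" "set u = {..<(n + 1) div 2}" and v: "distinct v" "set v = {..<n div 2}"
      using that by (auto simp: free_perms_def)
    have "2 * x \<noteq> 2 * y + 1" for x y :: nat by presburger
    then have "distinct (?f (u, v))"
      using u(1) v(1) by (auto simp: distinct_map inj_on_def)
    moreover have "set (?f (u, v)) \<subseteq> {..<n}"
      using u(2) v(2) half_less[of _ n] by auto
    moreover have "ordered n 0 (?f (u, v))"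
      by (auto simp: ordered_def before_append)
    ultimately show ?thesis using half[of u v] that by (simp add: interleavings_def)
  qed
  then have "?f ` (?X \<times> ?Y) \<subseteq> interleavings n 0 ?X ?Y" by auto
  moreover have "inj_on ?f (?X \<times> ?Y)"
  proof (rule inj_onI)
    fix p p' assume "?f p = ?f p'"
    then have "half 0 (?f p) = half 0 (?f p')" "half 1 (?f p) = half 1 (?f p')" by simp_all
    then show "p = p'" using half[of "fst p" "snd p"] half[of "fst p'" "snd p'"] by (simp add: prod_eq_iff)
  qed
  moreover have "finite (interleavings n 0 ?X ?Y)"
    using finite_free_perms[of n] free_perms_eq_interleavings[OF assms] by simp
  ultimately have "card (?X \<times> ?Y) \<le> card (interleavings n 0 ?X ?Y)"
    by (metis card_image card_mono)
  then show ?thesis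
    using card_free_perms[OF assms] by (simp add: theta_eq_card_free_perms card_cartesian_product)
qed

lemmas growth_rules = theta_values power_numeral pow.simps sqr.simps arith_simps rel_simps simp_thms list.set ball_simps

text \<open>262/119 is a convenient upper bound for the 80th root of \<open>2 * theta 80\<close>, the base of the growth rate.\<close>

lemma growth:
  "\<forall>n\<in>set [23, 24, 25, 26, 27, 28, 29, 30, 31, 32, 33, 34, 35, 36, 44, 45, 74, 75, 76, 77, 78, 79, 81, 82, 83, 84, 85, 86].
     262 ^ n \<le> 2 * theta n * 119 ^ n"
  by (simp only: growth_rules)

text \<open>One half of 73 is 37, where the bound itself fails; the surplus at 36 makes up for it in
  the product of the exact values. At 87 the surplus of 44 does the same for 43.\<close>

lemma growth_73: "262 ^ 73 \<le> 2 * theta 73 * 119 ^ 73"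
proof -
  have "262 ^ 73 \<le> 2 * (2 * theta 37 * theta 36) * 119 ^ 73"
    by (simp only: growth_rules)
  also have "\<dots> \<le> 2 * theta 73 * 119 ^ 73"
    using theta_halves[of 73] by (intro mult_right_mono mult_left_mono) simp_all
  finally show ?thesis .
qed

lemma growth_87: "262 ^ 87 \<le> 2 * theta 87 * 119 ^ 87"
proof -
  have "262 ^ 87 \<le> 2 * (2 * theta 44 * theta 43) * 119 ^ 87"
    by (simp only: growth_rules)
  also have "\<dots> \<le> 2 * theta 87 * 119 ^ 87"
    using theta_halves[of 87] by (intro mult_right_mono mult_left_mono) simp_all
  finally show ?thesis .
qed

text \<open>Strong induction by halving, with the excluded range 37..43 chosen so that no remaining
  case needs a bound inside it. At 80 the assumed equality replaces the comparison with
  262/119.\<close>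

lemma power_le_two_theta:
  fixes c :: real
  assumes c: "0 \<le> c" "c \<le> 262 / 119" "c ^ 80 = 2 * real (theta 80)"
  shows "n \<ge> 23 \<Longrightarrow> n \<notin> {37..43} \<Longrightarrow> c ^ n \<le> 2 * real (theta n)"
proof (induction n rule: less_induct)
  case (less n)
  let ?D = "[23, 24, 25, 26, 27, 28, 29, 30, 31, 32, 33, 34, 35, 36, 44, 45, 74, 75, 76, 77, 78, 79, 81, 82, 83, 84, 85, 86]"
  show ?case
  proof (cases "n \<in> set ?D \<or> n = 73 \<or> n = 87")
    case True
    then have "262 ^ n \<le> 2 * theta n * 119 ^ n"
      using bspec[OF growth] growth_73 growth_87 by blast
    then have "real (262 ^ n) \<le> real (2 * theta n * 119 ^ n)" by (rule of_nat_mono)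
    then have "(262 / 119) ^ n \<le> 2 * real (theta n)"
      by (simp add: power_divide divide_le_eq)
    moreover have "c ^ n \<le> (262 / 119) ^ n" using c by (intro power_mono) auto
    ultimately show ?thesis by linarith
  next
    case False
    show ?thesis
    proof (cases "n = 80")
      case True
      then show ?thesis using c(3) by simp
    next
      case n80: False
      let ?a = "(n + 1) div 2" and ?b = "n div 2"
      have "n \<in> {46..72} \<or> n \<ge> 88"
      proof -
        have "(n \<in> set ?D \<or> n = 73 \<or> n = 87) \<or> n = 80 \<or> n \<in> {46..72} \<or> n \<ge> 88" using less.prems
          by (simp, presburger)
        then show ?thesis using False n80 by blast
      qed
      \<comment> \<open>The halves of 46..72 lie in 23..36, and those of every n \<ge> 88 are at
        least 44.\<close>
      then have ab: "?a \<ge> 23" "?a \<notin> {37..43}" "?a < n" "?b \<ge> 23" "?b \<notin> {37..43}" "?b < n" by auto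
      have "n = ?a + ?b" by presburger
      then have "c ^ n = c ^ ?a * c ^ ?b" by (metis power_add)
      also have "\<dots> \<le> (2 * real (theta ?a)) * (2 * real (theta ?b))"
        using less.IH[of ?a] less.IH[of ?b] ab c(1) by (intro mult_mono) auto
      also have "\<dots> = 2 * real (2 * theta ?a * theta ?b)" by simp
      also have "\<dots> \<le> 2 * real (theta n)"
        using theta_halves[of n] less.prems by (intro mult_left_mono of_nat_mono) auto
      finally show ?thesis .
    qed
  qed
qed

theorem theorem1:
  fixes c1 :: real
  assumes "c1 = root 80 (2 * real (theta 80))"
  shows "theta 80 = 1302375489530691442230524528 \<and>
         2.201 \<le> c1 \<and> c1 < 2.202 \<and>
         (\<forall>n\<ge>45. real (theta n) \<ge> c1 ^ n / 2)"
proof (intro conjI)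
  have c80: "c1 ^ 80 = 2 * real (theta 80)" and c0: "0 \<le> c1"
    unfolding assms by simp_all
  have val: "2 * real (theta 80) = 2604750979061382884461049056"
    by (simp add: theta_80)
  show "theta 80 = 1302375489530691442230524528" by (rule theta_80)
  have "(2.201 :: real) ^ 80 \<le> 2604750979061382884461049056"
    by (simp add: power_divide divide_le_eq)
  then show "2.201 \<le> c1"
    \<comment> \<open>The rule compares powers with exponent \<open>Suc 79\<close>, that is
      80.\<close>
    using c80 val c0 by (intro power_le_imp_le_base[of "2.201" 79 c1]) simp_all
  have "2604750979061382884461049056 \<le> (262 / 119 :: real) ^ 80"
    by (simp add: power_divide le_divide_eq)
  then have le: "c1 \<le> 262 / 119"
    using c80 val by (intro power_le_imp_le_base[of c1 79]) simp_all
  then show "c1 < 2.202" by simp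
  show "\<forall>n\<ge>45. real (theta n) \<ge> c1 ^ n / 2"
  proof (intro allI impI)
    fix n :: nat assume "n \<ge> 45"
    then show "real (theta n) \<ge> c1 ^ n / 2"
      using power_le_two_theta[OF c0 le c80, of n] by simp
  qed
qed

end
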